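(* Let $\eta=(\eta_1,\dots,\eta_p)$ be a composition of $n$ with positive parts. On the set $Y_\eta$, the function $\gamma\mapsto K_{\Phi(\eta)}(\gamma)$ is a continuous piecewise polynomial function of degree $\sum_{1\le i<j\le p}\eta_i\eta_j-n+1$.
   Context: $r_k=\eta_1+\cdots+\eta_k$, $r_0=0$. $\Phi(\eta)=\{(i,j):1\le i\le r_k<j\le n\text{ for some }k\}$; for $\gamma\in\mathbb{Z}^n$ with $\sum\gamma_i=0$, $K_{\Phi(\eta)}(\gamma)$ is the number of families $(m_{ij})_{(i,j)\in\Phi(\eta)}$ of non-negative integers with $\sum_j m_{ij}-\sum_j m_{ji}=\gamma_i$ for all $i$. $Y_\eta$ is the set of $\gamma\in\mathbb{Z}^n$ with $\sum\gamma_i=0$ such that for each $0\le k\le p-1$ and every $\Omega\subseteq\{r_k+1,\dots,r_{k+1}\}$, $\sum_{j\le r_k}\gamma_j+\sum_{a\in\Omega}\gamma_a\ge0$.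
   Formalization: When the composition has a single part n ≥ 2, the stated degree 1−n is negative although the function is the constant 1 on Y_η = {0}; the degree is there taken to be 0, i.e. the formula is read as its maximum with 0. *)

theory Defs
  imports "HOL-Analysis.Analysis"
begin

text \<open>
  Vectors of length \<open>n\<close> are functions on \<open>nat\<close> that vanish outside \<open>{1..n}\<close>. On real
  vectors the product topology of \<open>nat \<Rightarrow> real\<close> then induces the usual topology of
  Euclidean \<open>n\<close>-space. A composition is the list of its parts.
\<close>

definition vecs :: "nat \<Rightarrow> (nat \<Rightarrow> 'a::zero) set" where
  "vecs n = {x. \<forall>i. i \<notin> {1..n} \<longrightarrow> x i = 0}"

definition psum :: "nat list \<Rightarrow> nat \<Rightarrow> nat" where
  "psum \<eta> k = sum_list (take k \<eta>)"

definition Phi :: "nat list \<Rightarrow> (nat \<times> nat) set" where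
  "Phi \<eta> = {(i, j). \<exists>k\<le>length \<eta>. 1 \<le> i \<and> i \<le> psum \<eta> k \<and> psum \<eta> k < j \<and> j \<le> sum_list \<eta>}"

definition kostant :: "nat \<Rightarrow> (nat \<times> nat) set \<Rightarrow> (nat \<Rightarrow> int) \<Rightarrow> nat" where
  "kostant n \<Phi> \<gamma> = card {m :: nat \<times> nat \<Rightarrow> nat.
     (\<forall>e. e \<notin> \<Phi> \<longrightarrow> m e = 0) \<and>
     (\<forall>i\<in>{1..n}. (\<Sum>j | (i, j) \<in> \<Phi>. int (m (i, j))) - (\<Sum>j | (j, i) \<in> \<Phi>. int (m (j, i))) = \<gamma> i)}"

text \<open>
  At type \<open>int\<close> this is the set of lattice points on which the partition function is
  considered; at type \<open>real\<close> it is the closed cone cut out by the same conditions.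
\<close>

definition Y :: "nat list \<Rightarrow> (nat \<Rightarrow> 'a::linordered_idom) set" where
  "Y \<eta> = {\<gamma> \<in> vecs (sum_list \<eta>). (\<Sum>i=1..sum_list \<eta>. \<gamma> i) = 0 \<and>
     (\<forall>k<length \<eta>. \<forall>\<Omega>. \<Omega> \<subseteq> {psum \<eta> k + 1..psum \<eta> (k + 1)} \<longrightarrow>
        0 \<le> (\<Sum>j=1..psum \<eta> k. \<gamma> j) + (\<Sum>a\<in>\<Omega>. \<gamma> a))}"

definition polyhedral_cone :: "nat \<Rightarrow> (nat \<Rightarrow> real) set \<Rightarrow> bool" where
  "polyhedral_cone n C \<longleftrightarrow>
     (\<exists>L :: (nat \<Rightarrow> real) set. finite L \<and> C = {x \<in> vecs n. \<forall>a\<in>L. 0 \<le> (\<Sum>i=1..n. a i * x i)})"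

definition polynomial_fun :: "nat \<Rightarrow> nat \<Rightarrow> ((nat \<Rightarrow> real) \<Rightarrow> real) \<Rightarrow> bool" where
  \<comment> \<open>polynomial function in the coordinates \<open>1, \<dots>, n\<close>, of total degree at most \<open>d\<close>\<close>
  "polynomial_fun n d f \<longleftrightarrow>
     (\<exists>(A :: (nat \<Rightarrow> nat) set) c. finite A \<and> (\<forall>\<alpha>\<in>A. (\<Sum>i=1..n. \<alpha> i) \<le> d) \<and>
        f = (\<lambda>x. \<Sum>\<alpha>\<in>A. c \<alpha> * (\<Prod>i=1..n. x i ^ \<alpha> i)))"

text \<open>
  The pieces are polyhedral cones, and they are required to cover all real points of the
  domain. Both matter when a function is only known on lattice points: every nonempty open
  cone contains lattice points, so a jump across a wall cannot be hidden in a region without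
  lattice points.
\<close>

definition piecewise_polynomial_on ::
    "nat \<Rightarrow> nat \<Rightarrow> (nat \<Rightarrow> real) set \<Rightarrow> ((nat \<Rightarrow> real) \<Rightarrow> real) \<Rightarrow> bool" where
  "piecewise_polynomial_on n d D F \<longleftrightarrow>
     (\<exists>\<C>. finite \<C> \<and> \<Union>\<C> = D \<and>
        (\<forall>C\<in>\<C>. polyhedral_cone n C \<and> (\<exists>f. polynomial_fun n d f \<and> (\<forall>x\<in>C. F x = f x))))"

text \<open>
  The degree is the least possible bound on the degrees of the pieces. Degrees of chosen
  polynomials would be ambiguous, since the domain may lie in a proper subspace.
  If the composition has a single part and \<open>n \<ge> 2\<close>, then \<open>Y \<eta>\<close> is the single point 0, where
  the partition function is 1, of degree 0; the degree formula gives the negative number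
  \<open>1 - n\<close> there, and is to be read as \<open>max 0\<close> of its value. In all other cases it is nonnegative.
\<close>

definition piecewise_polynomial_of_degree_on ::
    "nat \<Rightarrow> nat \<Rightarrow> (nat \<Rightarrow> real) set \<Rightarrow> ((nat \<Rightarrow> real) \<Rightarrow> real) \<Rightarrow> bool" where
  "piecewise_polynomial_of_degree_on n d D F \<longleftrightarrow>
     piecewise_polynomial_on n d D F \<and> (\<forall>d'<d. \<not> piecewise_polynomial_on n d' D F)"

end

theory Submission
  imports Defs
begin

text \<open>
  Let \<open>E\<close> be a set of edges containing a spanning tree. By induction on the number of edges
  outside this tree one gets, for lattice points \<open>\<gamma>\<close> and a small generic vector \<open>\<epsilon>\<close> in the cone
  of the tree, that \<open>K E \<gamma> = (\<Sum>B. [\<gamma> + \<epsilon> \<in> cone B] * p B \<gamma>)\<close>,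
  where \<open>B\<close> runs over spanning trees and \<open>p B\<close> is a polynomial of degree at most \<open>|E| - (n - 1)\<close>:
  adding an edge \<open>e\<close> means summing over \<open>\<gamma> - m e\<close>, the line leaves or enters the cone of \<open>B\<close> through
  a facet, which is the same as \<open>\<gamma> + \<epsilon>\<close> lying in the cone of an exchanged tree \<open>B - b + e\<close>, and by
  unimodularity the endpoints of the sum are affine functions of \<open>\<gamma>\<close> with integral values. Hence \<open>K\<close> is
  polynomial on the lattice points of every closed cell of the arrangement of tree coordinates, since
  \<open>\<epsilon>\<close> may be taken in the cell: a greedy transport shows that every generic point of \<open>Y\<close> lies in
  the cone of a spanning tree. The polynomials of two cells agree on the lattice points of the
  intersection, hence on the intersection by Diophantine approximation. This gives a continuous
  extension. The degree is attained along a ray inside the cone of a tree, where the flows on the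
  other edges can be chosen freely.
\<close>

subsection \<open>Polynomial functions\<close>

text \<open>The shift is what makes the induction exact. Closed cones overlap along walls, so an
  identity between unshifted indicators would need corrections of lower dimension; after the shift
  no lattice point lies on a wall, breakpoints are non-integral, and a line crosses one facet at a
  time. The price is that the formula depends on the shift and that the induction can start only
  from a tree whose cone contains it: there the indicators before and after the shift agree on
  lattice points. A cell is therefore usable only if some tree cone contains one of its generic
  points, and this is where the inequalities of \<open>Y\<close> enter: they describe exactly the
  nonnegative combinations of edge vectors. All edges increase, so some linear functional is
  positive on them; this makes every count finite and every line leave every tree cone. Each edge
  outside the tree costs one summation and raises the degree bound by one, which explains
  |\<open>Phi\<close>| - (n - 1). Trees are treated as bases of the zero-sum space and exchanges as
  pivot steps, so that no paths or cycles have to be handled.\<close>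

lemma polynomial_fun_monom:
  "(\<Sum>i=1..n. \<alpha> i) \<le> d \<Longrightarrow> polynomial_fun n d (\<lambda>x. c * (\<Prod>i=1..n. x i ^ \<alpha> i))"
  unfolding polynomial_fun_def by (rule exI[of _ "{\<alpha>}"], rule exI[of _ "\<lambda>_. c"]) auto

lemma polynomial_fun_const: "polynomial_fun n d (\<lambda>x. c)"
  using polynomial_fun_monom[where \<alpha>="\<lambda>_. 0" and c=c] by simp

lemma polynomial_fun_var:
  assumes "i \<in> {1..n}"
  shows "polynomial_fun n 1 (\<lambda>x. x i)"
proof -
  have "(\<Prod>j=1..n. x j ^ of_bool (j = i)) = x i" for x :: "nat \<Rightarrow> real"
    using assms prod.delta[of "{1..n}" i "\<lambda>j. x j"] by (simp add: of_bool_def if_distrib cong: if_cong)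
  moreover have "(\<Sum>j=1..n. of_bool (j = i)) = (1::nat)"
    using assms by (simp add: of_bool_def)
  ultimately show ?thesis
    using polynomial_fun_monom[where \<alpha>="\<lambda>j. of_bool (j = i)" and n=n and d=1 and c=1] by simp
qed

lemma polynomial_fun_mono: "polynomial_fun n d f \<Longrightarrow> d \<le> d' \<Longrightarrow> polynomial_fun n d' f"
  unfolding polynomial_fun_def by (blast intro: order_trans)

lemma polynomial_fun_add:
  assumes "polynomial_fun n d f" "polynomial_fun n d g"
  shows "polynomial_fun n d (\<lambda>x. f x + g x)"
proof -
  let ?m = "\<lambda>(x::nat\<Rightarrow>real) \<alpha>. (\<Prod>i=1..n. x i ^ \<alpha> i)"
  obtain A c where A: "finite A" "\<forall>\<alpha>\<in>A. (\<Sum>i=1..n. \<alpha> i) \<le> d" "f = (\<lambda>x. \<Sum>\<alpha>\<in>A. c \<alpha> * ?m x \<alpha>)"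
    using assms(1) unfolding polynomial_fun_def by blast
  obtain A' c' where A': "finite A'" "\<forall>\<alpha>\<in>A'. (\<Sum>i=1..n. \<alpha> i) \<le> d" "g = (\<lambda>x. \<Sum>\<alpha>\<in>A'. c' \<alpha> * ?m x \<alpha>)"
    using assms(2) unfolding polynomial_fun_def by blast
  let ?c = "\<lambda>\<alpha>. (if \<alpha> \<in> A then c \<alpha> else 0) + (if \<alpha> \<in> A' then c' \<alpha> else 0)"
  have "f x + g x = (\<Sum>\<alpha>\<in>A \<union> A'. ?c \<alpha> * ?m x \<alpha>)" for x
  proof -
    have "f x = (\<Sum>\<alpha>\<in>A \<union> A'. (if \<alpha> \<in> A then c \<alpha> else 0) * ?m x \<alpha>)"
      unfolding A(3) by (rule sum.mono_neutral_cong_left) (use A A' in auto)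
    moreover have "g x = (\<Sum>\<alpha>\<in>A \<union> A'. (if \<alpha> \<in> A' then c' \<alpha> else 0) * ?m x \<alpha>)"
      unfolding A'(3) by (rule sum.mono_neutral_cong_left) (use A A' in auto)
    ultimately show ?thesis by (simp add: sum.distrib ring_distribs)
  qed
  then show ?thesis
    unfolding polynomial_fun_def using A A'
    by (intro exI[of _ "A \<union> A'"] exI[of _ ?c]) auto
qed

lemma polynomial_fun_sum:
  "(\<And>k. k \<in> I \<Longrightarrow> polynomial_fun n d (f k)) \<Longrightarrow> polynomial_fun n d (\<lambda>x. \<Sum>k\<in>I. f k x)"
  by (induction I rule: infinite_finite_induct) (auto intro: polynomial_fun_const polynomial_fun_add)

lemma polynomial_fun_mult:
  assumes "polynomial_fun n d f" "polynomial_fun n d' g"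
  shows "polynomial_fun n (d + d') (\<lambda>x. f x * g x)"
proof -
  let ?m = "\<lambda>(x::nat\<Rightarrow>real) \<alpha>. (\<Prod>i=1..n. x i ^ \<alpha> i)"
  obtain A c where A: "finite A" "\<forall>\<alpha>\<in>A. (\<Sum>i=1..n. \<alpha> i) \<le> d" "f = (\<lambda>x. \<Sum>\<alpha>\<in>A. c \<alpha> * ?m x \<alpha>)"
    using assms(1) unfolding polynomial_fun_def by blast
  obtain A' c' where A': "finite A'" "\<forall>\<alpha>\<in>A'. (\<Sum>i=1..n. \<alpha> i) \<le> d'" "g = (\<lambda>x. \<Sum>\<alpha>\<in>A'. c' \<alpha> * ?m x \<alpha>)"
    using assms(2) unfolding polynomial_fun_def by blast
  have eq: "f x * g x = (\<Sum>\<alpha>\<in>A. \<Sum>\<beta>\<in>A'. (c \<alpha> * c' \<beta>) * ?m x (\<lambda>i. \<alpha> i + \<beta> i))" for x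
    unfolding A(3) A'(3) sum_product
    by (simp add: power_add prod.distrib mult_ac)
  show ?thesis unfolding eq
    by (intro polynomial_fun_sum polynomial_fun_monom)
       (use A A' in \<open>auto simp: sum.distrib intro!: add_mono\<close>)
qed

lemma polynomial_fun_power:
  "polynomial_fun n d f \<Longrightarrow> polynomial_fun n (k * d) (\<lambda>x. f x ^ k)"
  by (induction k) (auto intro: polynomial_fun_const polynomial_fun_mult)

lemma polynomial_fun_prod:
  "(\<And>k. k \<in> I \<Longrightarrow> polynomial_fun n (d k) (f k)) \<Longrightarrow>
     polynomial_fun n (\<Sum>k\<in>I. d k) (\<lambda>x. \<Prod>k\<in>I. f k x)"
  by (induction I rule: infinite_finite_induct) (auto intro: polynomial_fun_const polynomial_fun_mult)

lemma polynomial_fun_cmult: "polynomial_fun n d f \<Longrightarrow> polynomial_fun n d (\<lambda>x. c * f x)"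
  using polynomial_fun_mult[OF polynomial_fun_const[of n 0]] by simp

lemma polynomial_fun_compose_linear:
  assumes p: "polynomial_fun n d p"
    and s: "\<And>i. i \<in> {1..n} \<Longrightarrow> polynomial_fun m 1 (\<lambda>y. s y i)"
  shows "polynomial_fun m d (\<lambda>y. p (s y))"
proof -
  obtain A c where A: "finite A" "\<forall>\<alpha>\<in>A. (\<Sum>i=1..n. \<alpha> i) \<le> d"
    "p = (\<lambda>x. \<Sum>\<alpha>\<in>A. c \<alpha> * (\<Prod>i=1..n. x i ^ \<alpha> i))"
    using p unfolding polynomial_fun_def by blast
  have "polynomial_fun m (\<Sum>i=1..n. \<alpha> i * 1) (\<lambda>y. \<Prod>i=1..n. s y i ^ \<alpha> i)" for \<alpha>
    by (intro polynomial_fun_prod polynomial_fun_power s)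
  then show ?thesis
    unfolding A(3) using A(2)
    by (intro polynomial_fun_sum polynomial_fun_cmult) (auto intro: polynomial_fun_mono)
qed

lemma polynomial_fun_local:
  assumes "polynomial_fun n d p" "\<And>i. i \<in> {1..n} \<Longrightarrow> x i = y i"
  shows "p x = p y"
proof -
  obtain A c where "p = (\<lambda>x. \<Sum>\<alpha>\<in>A. c \<alpha> * (\<Prod>i=1..n. x i ^ \<alpha> i))"
    using assms(1) unfolding polynomial_fun_def by blast
  then show ?thesis using assms(2) by simp
qed

lemma polynomial_fun_tendsto:
  assumes "polynomial_fun n d p" "\<And>i. i \<in> {1..n} \<Longrightarrow> ((\<lambda>k. X k i) \<longlongrightarrow> x i) G"
  shows "((\<lambda>k. p (X k)) \<longlongrightarrow> p x) G"
proof -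
  obtain A c where "p = (\<lambda>x. \<Sum>\<alpha>\<in>A. c \<alpha> * (\<Prod>i=1..n. x i ^ \<alpha> i))"
    using assms(1) unfolding polynomial_fun_def by blast
  then show ?thesis using assms(2) by (auto intro!: tendsto_intros)
qed

lemma polynomial_fun_continuous:
  assumes "polynomial_fun n d p"
  shows "continuous_on S p"
proof -
  obtain A c where "p = (\<lambda>x. \<Sum>\<alpha>\<in>A. c \<alpha> * (\<Prod>i=1..n. x i ^ \<alpha> i))"
    using assms(1) unfolding polynomial_fun_def by blast
  moreover have "continuous_on S (\<lambda>x::nat \<Rightarrow> real. x i)" for i
    by (rule continuous_on_subset[OF continuous_on_product_coordinates]) simp
  ultimately show ?thesis by (auto intro!: continuous_intros)
qed

text \<open>Grouping the monomials by total degree turns the restriction to a line through 0 into a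
  univariate polynomial.\<close>

lemma polynomial_fun_ray:
  assumes "polynomial_fun n d p"
  obtains a where "\<And>t. p (\<lambda>i. t * x i) = (\<Sum>k\<le>d. a k * t ^ k)"
proof -
  obtain A c where A: "finite A" "\<forall>\<alpha>\<in>A. (\<Sum>i=1..n. \<alpha> i) \<le> d"
    "p = (\<lambda>x. \<Sum>\<alpha>\<in>A. c \<alpha> * (\<Prod>i=1..n. x i ^ \<alpha> i))"
    using assms unfolding polynomial_fun_def by blast
  let ?C = "\<lambda>\<alpha>. c \<alpha> * (\<Prod>i=1..n. x i ^ \<alpha> i)"
  let ?a = "\<lambda>k. \<Sum>\<alpha> | \<alpha> \<in> A \<and> (\<Sum>i=1..n. \<alpha> i) = k. ?C \<alpha>"
  have "p (\<lambda>i. t * x i) = (\<Sum>k\<le>d. ?a k * t ^ k)" for t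
  proof -
    have "p (\<lambda>i. t * x i) = (\<Sum>\<alpha>\<in>A. ?C \<alpha> * t ^ (\<Sum>i=1..n. \<alpha> i))"
      unfolding A(3) by (simp add: power_mult_distrib prod.distrib power_sum mult_ac)
    also have "\<dots> = (\<Sum>k\<le>d. \<Sum>\<alpha> | \<alpha> \<in> A \<and> (\<Sum>i=1..n. \<alpha> i) = k. ?C \<alpha> * t ^ (\<Sum>i=1..n. \<alpha> i))"
      by (rule sum.group[symmetric]) (use A in auto)
    also have "\<dots> = (\<Sum>k\<le>d. ?a k * t ^ k)"
      by (simp add: sum_distrib_right)
    finally show ?thesis .
  qed
  then show thesis by (rule that)
qed

text \<open>A univariate polynomial with infinitely many roots vanishes identically. Used at
  \<open>t\<close> = 1/q to pass from integral points of a cone to rational ones.\<close>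

lemma polynomial_fun_ray_eq_0:
  assumes "polynomial_fun n d p" "\<And>k::nat. p (\<lambda>i. real k * x i) = 0"
  shows "p (\<lambda>i. t * x i) = 0"
proof -
  obtain a where a: "\<And>t. p (\<lambda>i. t * x i) = (\<Sum>k\<le>d. a k * t ^ k)"
    using polynomial_fun_ray[OF assms(1), of x] by blast
  have "range real \<subseteq> {z. (\<Sum>k\<le>d. a k * z ^ k) = 0}"
    using assms(2) by (auto simp flip: a)
  then have "infinite {z. (\<Sum>k\<le>d. a k * z ^ k) = 0}"
    by (meson finite_subset infinite_UNIV_nat finite_imageD inj_of_nat)
  then have "\<forall>k\<le>d. a k = 0"
    using polyfun_finite_roots[of a d] by blast
  then show ?thesis by (simp add: a)
qed

text \<open>Upper half of the degree comparison: a polynomial of degree \<open>d\<close> cannot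
  outgrow \<open>k ^ d\<close> along a ray. The lower half is
  \<open>card_flows_growth\<close>.\<close>

lemma polynomial_fun_ray_bound:
  assumes "polynomial_fun n d p"
  obtains C where "\<And>k::nat. 1 \<le> k \<Longrightarrow> p (\<lambda>i. real k * x i) \<le> C * real k ^ d"
proof -
  obtain a where a: "\<And>t. p (\<lambda>i. t * x i) = (\<Sum>k\<le>d. a k * t ^ k)"
    using polynomial_fun_ray[OF assms(1), of x] by blast
  have "p (\<lambda>i. real k * x i) \<le> (\<Sum>j\<le>d. \<bar>a j\<bar>) * real k ^ d" if "1 \<le> k" for k
    unfolding a sum_distrib_right
  proof (rule sum_mono)
    fix j assume "j \<in> {..d}"
    then show "a j * real k ^ j \<le> \<bar>a j\<bar> * real k ^ d"
      using that by (intro mult_mono power_increasing) auto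
  qed
  then show thesis by (rule that)
qed

text \<open>Faulhaber's recursion: expand \<open>(t + 1) ^ (j + 1) - t ^ (j + 1)\<close> and solve
  for \<open>t ^ j\<close>. The value 0 at 0 later replaces the missing lower endpoint of a sum that
  starts at 0. Polynomiality is stated after substitution of an affine \<open>l\<close>, the only
  form in which it is used.\<close>

lemma power_antidifference:
  obtains S :: "real \<Rightarrow> real" where "S 0 = 0" "\<And>t. S (t + 1) - S t = t ^ j"
    "\<And>n l. polynomial_fun n 1 l \<Longrightarrow> polynomial_fun n (j + 1) (\<lambda>x. S (l x))"
proof -
  have "\<exists>S :: real \<Rightarrow> real. S 0 = 0 \<and> (\<forall>t. S (t + 1) - S t = t ^ j) \<and>
    (\<forall>n l. polynomial_fun n 1 l \<longrightarrow> polynomial_fun n (j + 1) (\<lambda>x. S (l x)))"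
  proof (induction j rule: less_induct)
    case (less j)
    then obtain S where S: "\<And>k. k < j \<Longrightarrow> S k 0 = (0::real)"
      "\<And>k t. k < j \<Longrightarrow> S k (t + 1) - S k t = t ^ k"
      "\<And>k n l. k < j \<Longrightarrow> polynomial_fun n 1 l \<Longrightarrow> polynomial_fun n (k + 1) (\<lambda>x. S k (l x))"
      by metis
    let ?S = "\<lambda>t. (t ^ (j + 1) + (\<Sum>k<j. - real ((j + 1) choose k) * S k t)) * (1 / real (j + 1))"
    have "?S (t + 1) - ?S t = t ^ j" for t
    proof -
      have "(t + 1) ^ (j + 1) = (\<Sum>k\<le>j + 1. real ((j + 1) choose k) * t ^ k)"
        using binomial_ring[of t 1 "j + 1"] by simp
      also have "\<dots> = (\<Sum>k<j. real ((j + 1) choose k) * t ^ k) + real (j + 1) * t ^ j + t ^ (j + 1)"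
        by (simp add: lessThan_Suc_atMost[symmetric])
      finally have 1: "(t + 1) ^ (j + 1) - t ^ (j + 1) - (\<Sum>k<j. real ((j + 1) choose k) * t ^ k)
          = real (j + 1) * t ^ j" by simp
      have "(\<Sum>k<j. real ((j + 1) choose k) * t ^ k)
          = (\<Sum>k<j. real ((j + 1) choose k) * (S k (t + 1) - S k t))"
        by (simp add: S(2))
      then have "?S (t + 1) - ?S t = ((t + 1) ^ (j + 1) - t ^ (j + 1) - (\<Sum>k<j. real ((j + 1) choose k) * t ^ k))
          * (1 / real (j + 1))"
        by (simp add: sum_negf sum_subtractf right_diff_distrib left_diff_distrib diff_divide_distrib add_divide_distrib)
      then show ?thesis unfolding 1 by simp
    qed
    moreover have "polynomial_fun n (j + 1) (\<lambda>x. ?S (l x))" if l: "polynomial_fun n 1 l" for n l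
    proof -
      have "polynomial_fun n (j + 1) (\<lambda>x. l x ^ (j + 1))"
        using polynomial_fun_power[OF l, of "j + 1"] by simp
      moreover have "polynomial_fun n (j + 1) (\<lambda>x. S k (l x))" if "k < j" for k
        using polynomial_fun_mono[OF S(3)[OF that l]] that by simp
      ultimately have "polynomial_fun n (j + 1)
          (\<lambda>x. (1 / real (j + 1)) * (l x ^ (j + 1) + (\<Sum>k<j. - real ((j + 1) choose k) * S k (l x))))"
        by (intro polynomial_fun_cmult polynomial_fun_add polynomial_fun_sum) auto
      then show ?thesis by (simp add: mult.commute)
    qed
    moreover have "?S 0 = 0" by (simp add: S(1))
    ultimately show ?case by (intro exI[of _ ?S]) blast
  qed
  then show thesis using that by blast
qed

text \<open>The parameter \<open>t\<close> becomes an extra coordinate \<open>Suc n\<close>, and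
  each monomial gets an antidifference in that coordinate alone. Substituting an affine endpoint for
  \<open>t\<close> then raises the total degree by only 1, however large the power of
  \<open>t\<close> is.\<close>

lemma polynomial_fun_antidifference:
  assumes p: "polynomial_fun n d p"
  obtains Q :: "(nat \<Rightarrow> real) \<Rightarrow> real \<Rightarrow> real" where "\<And>x. Q x 0 = 0"
    "\<And>x t. Q x (t + 1) - Q x t = p (\<lambda>i. x i - t * w i)"
    "\<And>l. polynomial_fun n 1 l \<Longrightarrow> polynomial_fun n (d + 1) (\<lambda>x. Q x (l x))"
proof -
  have "polynomial_fun (Suc n) d (\<lambda>y. p (\<lambda>i. y i + - w i * y (Suc n)))"
    by (rule polynomial_fun_compose_linear[OF p])
       (intro polynomial_fun_add polynomial_fun_cmult polynomial_fun_var; simp)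
  then obtain A c where A: "\<forall>\<alpha>\<in>A. (\<Sum>i=1..Suc n. \<alpha> i) \<le> d"
    "(\<lambda>y. p (\<lambda>i. y i + - w i * y (Suc n))) = (\<lambda>x. \<Sum>\<alpha>\<in>A. c \<alpha> * (\<Prod>i=1..Suc n. x i ^ \<alpha> i))"
    unfolding polynomial_fun_def by blast
  have "\<forall>j. \<exists>S :: real \<Rightarrow> real. S 0 = 0 \<and> (\<forall>t. S (t + 1) - S t = t ^ j) \<and>
      (\<forall>n l. polynomial_fun n 1 l \<longrightarrow> polynomial_fun n (j + 1) (\<lambda>x. S (l x)))"
    using power_antidifference by metis
  then obtain S :: "nat \<Rightarrow> real \<Rightarrow> real" where S: "\<And>j. S j 0 = 0" "\<And>j t. S j (t + 1) - S j t = t ^ j"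
    "\<And>j n l. polynomial_fun n 1 l \<Longrightarrow> polynomial_fun n (j + 1) (\<lambda>x. S j (l x))"
    by metis
  define Q where "Q = (\<lambda>x t. \<Sum>\<alpha>\<in>A. c \<alpha> * ((\<Prod>i=1..n. x i ^ \<alpha> i) * S (\<alpha> (Suc n)) t))"
  have "Q x (t + 1) - Q x t = p (\<lambda>i. x i - t * w i)" for x t
  proof -
    have "Q x (t + 1) - Q x t = (\<Sum>\<alpha>\<in>A. c \<alpha> * ((\<Prod>i=1..n. x i ^ \<alpha> i) * t ^ \<alpha> (Suc n)))"
      unfolding Q_def by (simp add: S(2)[symmetric] right_diff_distrib sum_subtractf)
    also have "\<dots> = (\<Sum>\<alpha>\<in>A. c \<alpha> * (\<Prod>i=1..Suc n. (x(Suc n := t)) i ^ \<alpha> i))"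
      by (intro sum.cong refl) simp
    also have "\<dots> = p (\<lambda>i. (x(Suc n := t)) i + - w i * (x(Suc n := t)) (Suc n))"
      using fun_cong[OF A(2), of "x(Suc n := t)"] by simp
    also have "\<dots> = p (\<lambda>i. x i - t * w i)"
      by (rule polynomial_fun_local[OF p]) auto
    finally show ?thesis .
  qed
  moreover have "polynomial_fun n (d + 1) (\<lambda>x. Q x (l x))" if l: "polynomial_fun n 1 l" for l
    unfolding Q_def
  proof (intro polynomial_fun_sum polynomial_fun_cmult)
    fix \<alpha> assume "\<alpha> \<in> A"
    then have "(\<Sum>i=1..n. \<alpha> i) + (\<alpha> (Suc n) + 1) \<le> d + 1"
      using A(1) by simp
    moreover have "polynomial_fun n ((\<Sum>i=1..n. \<alpha> i) + (\<alpha> (Suc n) + 1))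
        (\<lambda>x. (\<Prod>i=1..n. x i ^ \<alpha> i) * S (\<alpha> (Suc n)) (l x))"
      using polynomial_fun_monom[of \<alpha> n _ 1] by (intro polynomial_fun_mult S(3) l) simp
    ultimately show "polynomial_fun n (d + 1) (\<lambda>x. (\<Prod>i=1..n. x i ^ \<alpha> i) * S (\<alpha> (Suc n)) (l x))"
      by (rule polynomial_fun_mono[rotated])
  qed
  moreover have "Q x 0 = 0" for x by (simp add: Q_def S(1))
  ultimately show thesis using that by blast
qed

subsection \<open>Summation along a line\<close>

text \<open>With \<open>z b\<close> as coordinates of a point and \<open>c b\<close> as those of a
  direction, \<open>z b / c b\<close> is the time at which coordinate \<open>b\<close> vanishes; its
  term on the right survives only if this time is nonnegative and no other coordinate is negative
  then. Only the exit facet (\<open>c b = 1\<close>) and the entry facet (\<open>c b = -1\<close>)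
  survive, and their signs produce the telescoped difference of \<open>S\<close> at the two
  endpoints.\<close>

lemma line_sum:
  fixes z c :: "'b \<Rightarrow> real" and S :: "real \<Rightarrow> real"
  assumes fin: "finite B" and c: "\<And>b. b \<in> B \<Longrightarrow> c b \<in> {-1, 0, 1}"
    and up: "u \<in> B" "c u = 1"
    and S0: "S 0 = 0" and S: "\<And>m::nat. S (real m + 1) - S (real m) = p m"
    and nonint: "\<And>b. b \<in> B \<Longrightarrow> c b \<noteq> 0 \<Longrightarrow> z b \<notin> \<int>"
    and gen: "\<And>b b'. b \<in> B \<Longrightarrow> b' \<in> B \<Longrightarrow> b \<noteq> b' \<Longrightarrow> c b \<noteq> 0 \<Longrightarrow> z b' - z b / c b * c b' \<noteq> 0"
    and large: "\<And>b. b \<in> B \<Longrightarrow> z b \<le> real M"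
  shows "(\<Sum>m<M. of_bool (\<forall>b\<in>B. 0 \<le> z b - real m * c b) * p m) =
    (\<Sum>b\<in>B. of_bool (0 \<le> z b / c b \<and> (\<forall>b'\<in>B - {b}. 0 \<le> z b' - z b / c b * c b'))
       * (c b * S (of_int \<lceil>z b / c b\<rceil>)))"
proof -
  \<comment> \<open>\<open>U\<close> are the coordinates that decrease along the line and bound the
    admissible times from above, \<open>D\<close> those that increase and bound them from
    below.\<close>
  define U where "U = {b\<in>B. c b = 1}"
  define D where "D = {b\<in>B. c b = -1}"
  define Zok where "Zok = (\<forall>b\<in>B. c b = 0 \<longrightarrow> 0 \<le> z b)"
  \<comment> \<open>The 0 accounts for lines that start inside the orthant and enter through no
    facet.\<close>
  define t0 where "t0 = Max (insert 0 ((\<lambda>b. - z b) ` D))"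
  define G where "G b = (0 \<le> z b / c b \<and> (\<forall>b'\<in>B - {b}. 0 \<le> z b' - z b / c b * c b'))" for b
  have finU: "finite U" "finite D" using fin by (auto simp: U_def D_def)
  have "U \<noteq> {}" using up by (auto simp: U_def)
  then obtain b1 where b1: "b1 \<in> U" "\<And>b. b \<in> U \<Longrightarrow> z b1 \<le> z b"
    using arg_min_if_finite(1)[OF finU(1), of z] arg_min_least[OF finU(1), of _ z] by blast
  define t1 where "t1 = z b1"
  have b1B: "b1 \<in> B" "c b1 = 1" using b1 by (auto simp: U_def)
  have t0_le: "t0 \<le> t \<longleftrightarrow> 0 \<le> t \<and> (\<forall>b\<in>D. - z b \<le> t)" for t
    unfolding t0_def using finU by simp
  have all: "(\<forall>b\<in>B. 0 \<le> z b - t * c b) \<longleftrightarrow> Zok \<and> t0 \<le> t \<and> t \<le> t1" if "0 \<le> t" for t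
  proof
    assume a: "\<forall>b\<in>B. 0 \<le> z b - t * c b"
    have "Zok" unfolding Zok_def
    proof (intro ballI impI)
      fix b assume "b \<in> B" "c b = 0"
      then show "0 \<le> z b" using bspec[OF a, of b] by simp
    qed
    moreover have "t \<le> t1" using bspec[OF a b1B(1)] b1B(2) by (simp add: t1_def)
    moreover have "- z b \<le> t" if "b \<in> D" for b
      using bspec[OF a, of b] that by (simp add: D_def)
    ultimately show "Zok \<and> t0 \<le> t \<and> t \<le> t1" using t0_le[of t] that by simp
  next
    assume a: "Zok \<and> t0 \<le> t \<and> t \<le> t1"
    show "\<forall>b\<in>B. 0 \<le> z b - t * c b"
    proof
      fix b assume b: "b \<in> B"
      consider "c b = 0" | "b \<in> U" | "b \<in> D" using c[OF b] b by (auto simp: U_def D_def)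
      then show "0 \<le> z b - t * c b"
      proof cases
        case 1 then show ?thesis using a b by (auto simp: Zok_def)
      next
        case 2 then show ?thesis using a b1(2)[OF 2] by (simp add: U_def t1_def)
      next
        case 3
        then have "- z b \<le> t" using a t0_le[of t] by blast
        then show ?thesis using 3 by (simp add: D_def)
      qed
    qed
  qed
  have G_iff: "G b \<longleftrightarrow> Zok \<and> t0 \<le> z b / c b \<and> z b / c b \<le> t1" if "b \<in> B" "c b \<noteq> 0" for b
  proof (cases "0 \<le> z b / c b")
    case True
    have "G b \<longleftrightarrow> (\<forall>b'\<in>B. 0 \<le> z b' - z b / c b * c b')"
      unfolding G_def
    proof (intro iffI conjI ballI True)
      fix b' assume "0 \<le> z b / c b \<and> (\<forall>b'\<in>B - {b}. 0 \<le> z b' - z b / c b * c b')" "b' \<in> B"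
      then show "0 \<le> z b' - z b / c b * c b'" using that by (cases "b' = b") simp_all
    qed simp
    then show ?thesis using all[OF True] by simp
  next
    case False
    then show ?thesis using t0_le[of "z b / c b"] by (simp add: G_def)
  qed
  have sumU: "(\<Sum>b\<in>U. of_bool (G b) * (c b * S (of_int \<lceil>z b / c b\<rceil>)))
      = of_bool (Zok \<and> t0 \<le> t1) * S (of_int \<lceil>t1\<rceil>)"
  proof -
    \<comment> \<open>Genericity at the time of \<open>b1\<close> forbids a tie, so the exit facet
      is unique.\<close>
    have "\<not> G b" if "b \<in> U - {b1}" for b
    proof -
      have "b \<in> B" "c b = 1" "b \<noteq> b1" using that by (auto simp: U_def)
      then have "z b \<noteq> z b1" using gen[of b1 b] b1B by simp
      then show ?thesis
        using G_iff[of b] b1(2)[of b] that \<open>b \<in> B\<close> \<open>c b = 1\<close> by (simp add: t1_def)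
    qed
    then have "(\<Sum>b\<in>U. of_bool (G b) * (c b * S (of_int \<lceil>z b / c b\<rceil>)))
        = (\<Sum>b\<in>{b1}. of_bool (G b) * (c b * S (of_int \<lceil>z b / c b\<rceil>)))"
      by (intro sum.mono_neutral_right) (use finU b1 in auto)
    then show ?thesis using G_iff[OF b1B(1)] b1B by (simp add: t1_def)
  qed
  have sumD: "(\<Sum>b\<in>D. of_bool (G b) * (c b * S (of_int \<lceil>z b / c b\<rceil>)))
      = - of_bool (Zok \<and> t0 \<le> t1) * S (of_int \<lceil>t0\<rceil>)"
  proof -
    have GD: "G b \<longleftrightarrow> Zok \<and> t0 \<le> t1 \<and> - z b = t0" if "b \<in> D" for b
    proof -
      have "b \<in> B" "c b = -1" using that by (auto simp: D_def)
      moreover have "- z b \<le> t0" using t0_le[of t0] that by blast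
      ultimately show ?thesis using G_iff[of b] by auto
    qed
    show ?thesis
    proof (cases "t0 = 0")
      case True
      \<comment> \<open>No facet is entered here: \<open>- z b = 0\<close> would make
        \<open>z b\<close> an integer. The lower endpoint would contribute \<open>S 0 = 0\<close>,
        so its absence does no harm.\<close>
      have "\<not> G b" if "b \<in> D" for b
        using GD[OF that] nonint[of b] that True by (auto simp: D_def)
      then show ?thesis using True S0 by simp
    next
      case False
      have "t0 \<in> insert 0 ((\<lambda>b. - z b) ` D)" unfolding t0_def by (rule Max_in) (use finU in auto)
      then obtain b0 where b0: "b0 \<in> D" "- z b0 = t0" using False by auto
      have b0B: "b0 \<in> B" "c b0 = -1" using b0 by (auto simp: D_def)
      have "\<not> G b" if "b \<in> D - {b0}" for b
      proof -
        have "b \<in> B" "c b = -1" "b \<noteq> b0" using that by (auto simp: D_def)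
        then have "z b \<noteq> z b0" using gen[of b0 b] b0B by simp
        then show ?thesis using GD[of b] that b0 by auto
      qed
      then have "(\<Sum>b\<in>D. of_bool (G b) * (c b * S (of_int \<lceil>z b / c b\<rceil>)))
          = (\<Sum>b\<in>{b0}. of_bool (G b) * (c b * S (of_int \<lceil>z b / c b\<rceil>)))"
        by (intro sum.mono_neutral_right) (use finU b0 in auto)
      then show ?thesis using GD[OF b0(1)] b0 b0B by simp
    qed
  qed
  have "(\<Sum>b\<in>B. of_bool (G b) * (c b * S (of_int \<lceil>z b / c b\<rceil>)))
      = (\<Sum>b\<in>U \<union> D. of_bool (G b) * (c b * S (of_int \<lceil>z b / c b\<rceil>)))"
    by (rule sum.mono_neutral_right) (use c fin in \<open>auto simp: U_def D_def\<close>)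
  also have "\<dots> = (\<Sum>b\<in>U. of_bool (G b) * (c b * S (of_int \<lceil>z b / c b\<rceil>)))
      + (\<Sum>b\<in>D. of_bool (G b) * (c b * S (of_int \<lceil>z b / c b\<rceil>)))"
    by (rule sum.union_disjoint) (use finU in \<open>auto simp: U_def D_def\<close>)
  also have "\<dots> = of_bool (Zok \<and> t0 \<le> t1) * (S (of_int \<lceil>t1\<rceil>) - S (of_int \<lceil>t0\<rceil>))"
    unfolding sumU sumD by (simp add: algebra_simps)
  also have "\<dots> = (\<Sum>m<M. of_bool (Zok \<and> t0 \<le> real m \<and> real m \<le> t1) * p m)"
  proof (cases "Zok \<and> t0 \<le> t1")
    case True
    have t00: "0 \<le> t0" using t0_le[of t0] by blast
    define a b where "a = nat \<lceil>t0\<rceil>" and "b = nat \<lceil>t1\<rceil>"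
    have le: "0 \<le> \<lceil>t0\<rceil>" "\<lceil>t0\<rceil> \<le> \<lceil>t1\<rceil>"
      using t00 True by (simp_all add: ceiling_mono)
    then have ab: "real a = of_int \<lceil>t0\<rceil>" "real b = of_int \<lceil>t1\<rceil>" "a \<le> b"
      unfolding a_def b_def using order_trans[OF le] by (simp_all only: of_nat_nat nat_mono)
    \<comment> \<open>As \<open>t1\<close> is not an integer, \<open>real m \<le> t1\<close> is
      strict and the range of summation is the half-open \<open>{a..<b}\<close>.\<close>
    have t1: "t1 \<notin> \<int>" using nonint[of b1] b1B by (simp add: t1_def)
    have "t0 \<le> real m \<and> real m \<le> t1 \<longleftrightarrow> m \<in> {a..<b}" for m
    proof -
      have "t0 \<le> real m \<longleftrightarrow> a \<le> m" unfolding a_def by linarith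
      moreover have "real m \<noteq> t1" using t1 Ints_of_nat by blast
      then have "real m \<le> t1 \<longleftrightarrow> real m < t1" by linarith
      moreover have "real m < t1 \<longleftrightarrow> m < b" unfolding b_def by linarith
      ultimately show ?thesis by auto
    qed
    note iff = this
    have "b \<le> M" using large[OF b1B(1)] unfolding b_def t1_def by linarith
    then have sub: "{..<M} \<inter> {a..<b} = {a..<b}" by auto
    have "(\<Sum>m<M. of_bool (Zok \<and> t0 \<le> real m \<and> real m \<le> t1) * p m)
        = (\<Sum>m<M. if m \<in> {a..<b} then p m else 0)"
    proof (intro sum.cong refl)
      fix m
      have "(Zok \<and> t0 \<le> real m \<and> real m \<le> t1) = (m \<in> {a..<b})"
        using iff True by blast
      then show "of_bool (Zok \<and> t0 \<le> real m \<and> real m \<le> t1) * p m = (if m \<in> {a..<b} then p m else 0)"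
        by (simp only:) simp
    qed
    also have "\<dots> = (\<Sum>m\<in>{a..<b}. p m)"
      using sum.inter_restrict[of "{..<M}" p "{a..<b}"] unfolding sub by simp
    finally have "(\<Sum>m<M. of_bool (Zok \<and> t0 \<le> real m \<and> real m \<le> t1) * p m) = (\<Sum>m\<in>{a..<b}. p m)" .
    also have "\<dots> = (\<Sum>m\<in>{a..<b}. S (real (Suc m)) - S (real m))"
      using S by (intro sum.cong refl) (simp add: add.commute)
    also have "\<dots> = S (real b) - S (real a)"
      using ab(3) by (rule sum_Suc_diff')
    finally show ?thesis using True ab by simp
  next
    case False
    then have "\<not> (Zok \<and> t0 \<le> real m \<and> real m \<le> t1)" for m by linarith
    then have "(Zok \<and> t0 \<le> real m \<and> real m \<le> t1) = False" for m by blast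
    then show ?thesis using False by (simp only: of_bool_eq mult_zero_left sum.neutral_const)
  qed
  also have "\<dots> = (\<Sum>m<M. of_bool (\<forall>b\<in>B. 0 \<le> z b - real m * c b) * p m)"
    by (simp only: all[OF of_nat_0_le_iff])
  finally show ?thesis unfolding G_def by (rule sym)
qed

subsection \<open>Bases of an acyclic graph\<close>

definition ev :: "nat \<times> nat \<Rightarrow> nat \<Rightarrow> real" where
  "ev e v = of_bool (v = fst e) - of_bool (v = snd e)"

definition zero_sum :: "nat \<Rightarrow> (nat \<Rightarrow> real) set" where
  "zero_sum n = {x \<in> vecs n. (\<Sum>i=1..n. x i) = 0}"

definition lin :: "nat \<Rightarrow> (nat \<Rightarrow> real) \<Rightarrow> (nat \<Rightarrow> real) \<Rightarrow> real" where
  "lin n h x = (\<Sum>i=1..n. h i * x i)"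

lemma lin_sum: "lin n h (\<lambda>v. \<Sum>k\<in>I. t k * w k v) = (\<Sum>k\<in>I. t k * lin n h (w k))"
proof -
  have "lin n h (\<lambda>v. \<Sum>k\<in>I. t k * w k v) = (\<Sum>v=1..n. \<Sum>k\<in>I. t k * (h v * w k v))"
    unfolding lin_def by (simp add: sum_distrib_left mult_ac)
  also have "\<dots> = (\<Sum>k\<in>I. t k * lin n h (w k))"
    unfolding lin_def by (subst sum.swap) (simp add: sum_distrib_left)
  finally show ?thesis .
qed

lemma lin_add: "lin n h (\<lambda>v. x v + y v) = lin n h x + lin n h y"
  and lin_diff: "lin n h (\<lambda>v. x v - y v) = lin n h x - lin n h y"
  and lin_scale: "lin n h (\<lambda>v. t * x v) = t * lin n h x"
  unfolding lin_def by (simp_all add: sum.distrib sum_subtractf sum_distrib_left algebra_simps)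

lemma lin_coeff: "lin n (\<lambda>v. s * h v + t * g v) x = s * lin n h x + t * lin n g x"
  unfolding lin_def by (simp add: sum.distrib sum_distrib_left algebra_simps)

lemma lin_ev:
  assumes "fst e \<in> {1..n}" "snd e \<in> {1..n}"
  shows "lin n h (ev e) = h (fst e) - h (snd e)"
proof -
  have "lin n h (ev e) = (\<Sum>i=1..n. (if i = fst e then h i else 0) - (if i = snd e then h i else 0))"
    unfolding lin_def ev_def by (intro sum.cong) auto
  then show ?thesis using assms by (simp add: sum_subtractf)
qed

lemma ev_zero_sum: "fst e \<in> {1..n} \<Longrightarrow> snd e \<in> {1..n} \<Longrightarrow> ev e \<in> zero_sum n"
  using lin_ev[of e n "\<lambda>_. 1"] by (auto simp: zero_sum_def vecs_def lin_def) (auto simp: ev_def)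

lemma zero_sum_add: "x \<in> zero_sum n \<Longrightarrow> y \<in> zero_sum n \<Longrightarrow> (\<lambda>v. x v + y v) \<in> zero_sum n"
  and zero_sum_scale: "x \<in> zero_sum n \<Longrightarrow> (\<lambda>v. t * x v) \<in> zero_sum n"
  by (auto simp: zero_sum_def vecs_def sum.distrib simp flip: sum_distrib_left)

lemma zero_sum_diff_scale: "x \<in> zero_sum n \<Longrightarrow> y \<in> zero_sum n \<Longrightarrow> (\<lambda>v. x v - t * y v) \<in> zero_sum n"
  by (auto simp: zero_sum_def vecs_def sum_subtractf simp flip: sum_distrib_left)

lemma zero_sum_sum:
  "(\<And>k. k \<in> I \<Longrightarrow> w k \<in> zero_sum n) \<Longrightarrow> (\<lambda>v. \<Sum>k\<in>I. t k * w k v) \<in> zero_sum n"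
  by (induction I rule: infinite_finite_induct)
     (auto intro!: zero_sum_add zero_sum_scale, auto simp: zero_sum_def vecs_def)

text \<open>Spanning trees in the language of linear algebra: the edge vectors form a basis of the
  zero-sum space, and the potentials \<open>h b\<close> represent the dual basis.\<close>

definition dual_basis :: "nat \<Rightarrow> (nat \<times> nat) set \<Rightarrow> (nat \<times> nat \<Rightarrow> nat \<Rightarrow> real) \<Rightarrow> bool" where
  "dual_basis n B h \<longleftrightarrow> card B = n - 1 \<and>
     (\<forall>b\<in>B. \<forall>b'\<in>B. lin n (h b) (ev b') = of_bool (b = b')) \<and>
     (\<forall>x\<in>zero_sum n. \<forall>v. x v = (\<Sum>b\<in>B. lin n (h b) x * ev b v))"

locale dag =
  fixes n :: nat and \<Phi> :: "(nat \<times> nat) set"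
  assumes edge: "e \<in> \<Phi> \<Longrightarrow> 1 \<le> fst e \<and> fst e < snd e \<and> snd e \<le> n"
begin

definition bases :: "(nat \<times> nat) set set" where
  "bases = {B. B \<subseteq> \<Phi> \<and> (\<exists>h. dual_basis n B h)}"

text \<open>On \<open>{1..n}\<close> the potential of a basis edge is determined only up to an
  additive constant, hence the choice; its functional on zero-sum vectors does not depend on
  it.\<close>

definition pot :: "(nat \<times> nat) set \<Rightarrow> nat \<times> nat \<Rightarrow> nat \<Rightarrow> real" where
  "pot B = (SOME h. dual_basis n B h)"

definition co :: "(nat \<times> nat) set \<Rightarrow> nat \<times> nat \<Rightarrow> (nat \<Rightarrow> real) \<Rightarrow> real" where
  "co B b x = lin n (pot B b) x"

lemma edge_range:
  assumes "e \<in> \<Phi>"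
  shows "fst e \<in> {1..n}" "snd e \<in> {1..n}"
  using edge[OF assms] by auto

lemma finite_edges: "finite \<Phi>"
proof (rule finite_subset)
  show "\<Phi> \<subseteq> {1..n} \<times> {1..n}" using edge_range by (auto simp: mem_Times_iff)
qed auto

lemma finite_bases: "finite bases"
  using finite_edges by (intro finite_subset[of bases "Pow \<Phi>"]) (auto simp: bases_def)

lemma ev_edge: "e \<in> \<Phi> \<Longrightarrow> ev e \<in> zero_sum n"
  using ev_zero_sum edge_range by blast

lemma basesD:
  assumes "B \<in> bases"
  shows bases_sub: "B \<subseteq> \<Phi>" and bases_card: "card B = n - 1" and bases_finite: "finite B"
    and dual_pot: "dual_basis n B (pot B)"
proof -
  show 1: "B \<subseteq> \<Phi>" using assms by (simp add: bases_def)
  show "finite B" using finite_subset[OF 1 finite_edges] .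
  obtain h where "dual_basis n B h" using assms by (auto simp: bases_def)
  then show d: "dual_basis n B (pot B)" unfolding pot_def by (rule someI[of "dual_basis n B"])
  show "card B = n - 1" using d by (simp add: dual_basis_def)
qed

lemma co_ev: "B \<in> bases \<Longrightarrow> b \<in> B \<Longrightarrow> b' \<in> B \<Longrightarrow> co B b (ev b') = of_bool (b = b')"
  using dual_pot unfolding dual_basis_def co_def by blast

lemma co_expand: "B \<in> bases \<Longrightarrow> x \<in> zero_sum n \<Longrightarrow> x v = (\<Sum>b\<in>B. co B b x * ev b v)"
  using dual_pot unfolding dual_basis_def co_def by blast

lemma co_expand_lin:
  assumes "B \<in> bases" "x \<in> zero_sum n"
  shows "lin n h x = (\<Sum>b\<in>B. co B b x * lin n h (ev b))"
proof -
  have "x = (\<lambda>v. \<Sum>b\<in>B. co B b x * ev b v)"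
    by (rule ext) (rule co_expand[OF assms])
  then have "lin n h x = lin n h (\<lambda>v. \<Sum>b\<in>B. co B b x * ev b v)"
    by (rule arg_cong)
  then show ?thesis by (simp only: lin_sum)
qed

lemma co_unique:
  assumes "B \<in> bases" "b \<in> B" "\<And>v. x v = (\<Sum>b\<in>B. t b * ev b v)"
  shows "co B b x = t b"
proof -
  have "x = (\<lambda>v. \<Sum>b\<in>B. t b * ev b v)" using assms(3) by blast
  then have "co B b x = co B b (\<lambda>v. \<Sum>b\<in>B. t b * ev b v)"
    by (rule arg_cong)
  also have "\<dots> = (\<Sum>b'\<in>B. t b' * co B b (ev b'))"
    unfolding co_def by (simp only: lin_sum)
  also have "\<dots> = (\<Sum>b'\<in>B. if b' = b then t b' else 0)"
    by (intro sum.cong) (auto simp: co_ev assms)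
  finally show ?thesis using assms bases_finite by simp
qed

text \<open>
  A coordinate with respect to a basis is given by a potential, which jumps by 1 along one
  basis edge and is constant along the others. Its threshold at the top of the jump has the same
  values on the basis, so the coordinate is given by a cut.
\<close>

lemma co_unimodular:
  assumes B: "B \<in> bases" "b \<in> B" and e: "fst e \<in> {1..n}" "snd e \<in> {1..n}"
  shows "co B b (ev e) \<in> {-1, 0, 1}"
proof -
  let ?h = "pot B b"
  define g where "g v = (of_bool (?h v \<ge> ?h (fst b)) :: real)" for v
  have diff: "?h (fst b') - ?h (snd b') = of_bool (b = b')" if "b' \<in> B" for b'
    using co_ev[OF B that] lin_ev edge_range bases_sub[OF B(1)] that unfolding co_def by (metis subsetD)
  have g: "lin n g (ev b') = of_bool (b = b')" if "b' \<in> B" for b'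
  proof -
    have "lin n g (ev b') = g (fst b') - g (snd b')"
      using lin_ev edge_range bases_sub[OF B(1)] that by (metis subsetD)
    then show ?thesis using diff[OF that] by (auto simp: g_def)
  qed
  have "lin n g (ev e) = (\<Sum>b'\<in>B. co B b' (ev e) * of_bool (b = b'))"
    using co_expand_lin[OF B(1) ev_zero_sum[OF e], of g] g by simp
  also have "\<dots> = (\<Sum>b'\<in>B. if b' = b then co B b' (ev e) else 0)"
    by (intro sum.cong) auto
  also have "\<dots> = co B b (ev e)" using B bases_finite by simp
  finally show ?thesis using lin_ev[OF e, of g] by (auto simp: g_def of_bool_def split: if_splits)
qed

text \<open>The exchange step of the simplex method: solve the expansion of \<open>ev e\<close> for
  \<open>ev b\<close> and substitute. The new coordinates are exactly the expressions in
  \<open>line_sum\<close>, so a surviving term there says that the point lies in the cone of the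
  exchanged tree.\<close>

lemma pivot:
  fixes B b e
  defines "c \<equiv> co B b (ev e)" and "B' \<equiv> insert e (B - {b})"
  assumes B: "B \<in> bases" "b \<in> B" and e: "e \<in> \<Phi>" and c: "c \<noteq> 0"
  shows "B' \<in> bases"
    and "x \<in> zero_sum n \<Longrightarrow> co B' e x = co B b x / c"
    and "x \<in> zero_sum n \<Longrightarrow> b' \<in> B - {b} \<Longrightarrow> co B' b' x = co B b' x - co B b x / c * co B b' (ev e)"
proof -
  have fB: "finite B" using B bases_finite by blast
  define h where "h b' = (if b' = e then (\<lambda>v. (1 / c) * pot B b v + 0 * pot B b v)
    else (\<lambda>v. 1 * pot B b' v + (- (co B b' (ev e) / c)) * pot B b v))" for b'
  \<comment> \<open>If \<open>e\<close> already lies in \<open>B\<close>, the nonzero pivot forces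
    \<open>b = e\<close>, and the exchange changes nothing.\<close>
  have eB: "b = e \<and> c = 1" if "e \<in> B"
    using co_ev[OF B that] c unfolding c_def by (cases "b = e") simp_all
  have "lin n (h e) x = (1 / c) * lin n (pot B b) x + 0 * lin n (pot B b) x" for x
    unfolding h_def if_P[OF refl] by (rule lin_coeff)
  then have he: "lin n (h e) x = co B b x / c" for x
    by (simp add: co_def)
  have hb: "lin n (h b') x = co B b' x - co B b x / c * co B b' (ev e)" if "b' \<in> B - {b}" for b' x
  proof -
    have "b' \<noteq> e" using that eB by auto
    have "lin n (h b') x = 1 * lin n (pot B b') x + (- (co B b' (ev e) / c)) * lin n (pot B b) x"
      unfolding h_def if_not_P[OF \<open>b' \<noteq> e\<close>] by (rule lin_coeff)
    then show ?thesis by (simp add: co_def)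
  qed
  have fin': "finite (B - {b})" "e \<notin> B - {b}" using fB eB by auto
  have expand: "x v = (\<Sum>b'\<in>B'. lin n (h b') x * ev b' v)" if x: "x \<in> zero_sum n" for x v
  proof -
    have 1: "x v = co B b x * ev b v + (\<Sum>b'\<in>B - {b}. co B b' x * ev b' v)"
      using co_expand[OF B(1) x, of v] sum.remove[OF fB B(2)] by simp
    have 2: "ev e v = c * ev b v + (\<Sum>b'\<in>B - {b}. co B b' (ev e) * ev b' v)"
      using co_expand[OF B(1) ev_edge[OF e], of v] sum.remove[OF fB B(2)] by (simp add: c_def)
    have "(\<Sum>b'\<in>B'. lin n (h b') x * ev b' v)
        = co B b x / c * ev e v + (\<Sum>b'\<in>B - {b}. lin n (h b') x * ev b' v)"
      unfolding B'_def using fin' by (simp add: he)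
    also have "(\<Sum>b'\<in>B - {b}. lin n (h b') x * ev b' v)
        = (\<Sum>b'\<in>B - {b}. co B b' x * ev b' v - co B b x / c * (co B b' (ev e) * ev b' v))"
      by (intro sum.cong refl) (simp add: hb algebra_simps)
    also have "co B b x / c * ev e v + \<dots> = x v"
      unfolding 1 2 sum_subtractf sum_distrib_left[symmetric] using c by (simp add: algebra_simps)
    finally show ?thesis by simp
  qed
  have delta: "lin n (h b1) (ev b2) = of_bool (b1 = b2)" if "b1 \<in> B'" "b2 \<in> B'" for b1 b2
  proof -
    have k: "co B b (ev b2) = 0" if "b2 \<in> B - {b}" for b2
      using co_ev[OF B, of b2] that by auto
    show ?thesis
    proof (cases "b1 = e")
      case True
      show ?thesis
      proof (cases "b2 = e")
        case True
        then show ?thesis using \<open>b1 = e\<close> he c by (simp add: c_def)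
      next
        case False
        then have "b2 \<in> B - {b}" using that by (auto simp: B'_def)
        then show ?thesis using True False he k by simp
      qed
    next
      case False
      then have b1: "b1 \<in> B - {b}" using that by (auto simp: B'_def)
      show ?thesis
      proof (cases "b2 = e")
        case True
        then show ?thesis using hb[OF b1] False c by (simp add: c_def)
      next
        case False
        then have "b2 \<in> B - {b}" using that by (auto simp: B'_def)
        then show ?thesis using hb[OF b1] k co_ev[OF B(1), of b1 b2] b1 by simp
      qed
    qed
  qed
  have "card B' = n - 1"
    unfolding B'_def card_insert_disjoint[OF fin'] card_Suc_Diff1[OF fB B(2)] by (rule bases_card[OF B(1)])
  then have "dual_basis n B' h" using delta expand unfolding dual_basis_def by blast
  moreover have "B' \<subseteq> \<Phi>" using bases_sub[OF B(1)] e by (auto simp: B'_def)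
  ultimately show B': "B' \<in> bases" unfolding bases_def by blast
  have co': "co B' b' x = lin n (h b') x" if "x \<in> zero_sum n" "b' \<in> B'" for b' x
    by (rule co_unique[OF B' that(2)]) (rule expand[OF that(1)])
  show "x \<in> zero_sum n \<Longrightarrow> co B' e x = co B b x / c"
    using co'[of x e] he by (simp add: B'_def)
  show "x \<in> zero_sum n \<Longrightarrow> b' \<in> B - {b} \<Longrightarrow> co B' b' x = co B b' x - co B b x / c * co B b' (ev e)"
    using co'[of x b'] hb by (simp add: B'_def)
qed

subsection \<open>Counting flows\<close>

definition flows :: "(nat \<times> nat) set \<Rightarrow> (nat \<Rightarrow> real) \<Rightarrow> (nat \<times> nat \<Rightarrow> nat) set" where
  "flows E x = {m. (\<forall>e. e \<notin> E \<longrightarrow> m e = 0) \<and> (\<forall>v. (\<Sum>e\<in>E. real (m e) * ev e v) = x v)}"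

lemma flows_outside: "m \<in> flows E x \<Longrightarrow> e \<notin> E \<Longrightarrow> m e = 0"
  unfolding flows_def by blast

text \<open>The potential \<open>-v\<close> drops by at least 1 along every edge; acyclicity enters
  in the form of this functional.\<close>

definition height :: "(nat \<Rightarrow> real) \<Rightarrow> real" where
  "height x = lin n (\<lambda>v. - real v) x"

lemma height_edge: "e \<in> \<Phi> \<Longrightarrow> 1 \<le> height (ev e)"
  using lin_ev[of e n "\<lambda>v. - real v"] edge_range[of e] edge[of e] by (simp add: height_def)

text \<open>The height of \<open>x\<close> is the sum of the heights of the edges weighted by the
  flow. All terms are nonnegative and each edge has height at least 1, so no single value exceeds
  the total.\<close>

lemma flows_le_height:
  assumes E: "E \<subseteq> \<Phi>" and m: "m \<in> flows E x" and e: "e \<in> E"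
  shows "real (m e) \<le> height x"
proof -
  have fin: "finite E" using E finite_edges finite_subset by blast
  have "x = (\<lambda>v. \<Sum>e\<in>E. real (m e) * ev e v)" using m by (auto simp: flows_def)
  then have "height x = height (\<lambda>v. \<Sum>e\<in>E. real (m e) * ev e v)" by (rule arg_cong)
  also have "\<dots> = (\<Sum>e\<in>E. real (m e) * height (ev e))" unfolding height_def by (rule lin_sum)
  finally have h: "height x = (\<Sum>e\<in>E. real (m e) * height (ev e))" .
  have le: "real (m e') \<le> real (m e') * height (ev e')" if "e' \<in> E" for e'
  proof -
    have "1 \<le> height (ev e')" using height_edge that E by blast
    then show ?thesis using mult_left_mono[of 1 "height (ev e')" "real (m e')"] by simp
  qed
  have "0 \<le> real (m e') * height (ev e')" if "e' \<in> E" for e'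
    using le[OF that] order_trans[OF of_nat_0_le_iff] by blast
  then have "real (m e) * height (ev e) \<le> height x"
    unfolding h by (intro member_le_sum[OF e _ fin]) blast
  then show ?thesis using le[OF e] by linarith
qed

lemma finite_flows:
  assumes "E \<subseteq> \<Phi>"
  shows "finite (flows E x)"
proof (rule finite_subset)
  have "m e \<le> nat \<lfloor>height x\<rfloor>" if "m \<in> flows E x" "e \<in> E" for m e
    using flows_le_height[OF assms that] by linarith
  then show "flows E x \<subseteq> {m. \<forall>e. (e \<in> E \<longrightarrow> m e \<in> {..nat \<lfloor>height x\<rfloor>}) \<and> (e \<notin> E \<longrightarrow> m e = 0)}"
    by (auto simp: flows_def)
  show "finite {m. \<forall>e. (e \<in> E \<longrightarrow> m e \<in> {..nat \<lfloor>height x\<rfloor>}) \<and> (e \<notin> E \<longrightarrow> m e = (0::nat))}"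
    by (rule finite_set_of_finite_funs) (use assms finite_edges finite_subset in auto)
qed

text \<open>Flows are sorted by their value \<open>k\<close> on the new edge; values from
  \<open>M\<close> on are excluded by \<open>flows_le_height\<close>.\<close>

lemma card_flows_insert:
  assumes E: "E \<subseteq> \<Phi>" and e: "e \<in> \<Phi>" "e \<notin> E" and M: "height x < real M"
  shows "card (flows (insert e E) x) = (\<Sum>k<M. card (flows E (\<lambda>v. x v - real k * ev e v)))"
proof -
  have fin: "finite E" using E finite_edges finite_subset by blast
  have upd: "(\<Sum>e'\<in>E. real ((m(e := k)) e') * ev e' v) = (\<Sum>e'\<in>E. real (m e') * ev e' v)" for m k v
    by (rule sum.cong) (use e in auto)
  define G where "G k = (\<lambda>m. m(e := k)) ` flows E (\<lambda>v. x v - real k * ev e v)" for k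
  have "flows (insert e E) x = (\<Union>k<M. G k)"
  proof (intro equalityI subsetI)
    fix m assume m: "m \<in> flows (insert e E) x"
    have "real (m e) < real M"
      using flows_le_height[of "insert e E" m x e] m E e M by auto
    moreover have "m \<in> G (m e)"
      unfolding G_def
    proof (rule image_eqI)
      show "m = (m(e := 0))(e := m e)" by simp
      have "real (m e) * ev e v + (\<Sum>e'\<in>E. real (m e') * ev e' v) = x v" for v
        using m fin e by (simp add: flows_def)
      then have "(\<Sum>e'\<in>E. real ((m(e := 0)) e') * ev e' v) = x v - real (m e) * ev e v" for v
        unfolding upd by (simp add: algebra_simps)
      then show "m(e := 0) \<in> flows E (\<lambda>v. x v - real (m e) * ev e v)"
        using m by (simp add: flows_def)
    qed
    ultimately show "m \<in> (\<Union>k<M. G k)" using lessThan_iff by (simp only: UN_iff of_nat_less_iff) blast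
  next
    fix m assume "m \<in> (\<Union>k<M. G k)"
    then obtain k m' where m': "m' \<in> flows E (\<lambda>v. x v - real k * ev e v)" "m = m'(e := k)"
      by (auto simp: G_def)
    have "(\<Sum>e'\<in>insert e E. real (m e') * ev e' v) = x v" for v
    proof -
      have "(\<Sum>e'\<in>insert e E. real (m e') * ev e' v)
          = real k * ev e v + (\<Sum>e'\<in>E. real ((m'(e := k)) e') * ev e' v)"
        using fin e by (simp add: m'(2) del: fun_upd_apply) simp
      also have "\<dots> = x v" using m'(1) unfolding upd by (simp add: flows_def)
      finally show ?thesis .
    qed
    then show "m \<in> flows (insert e E) x" using m' by (simp add: flows_def)
  qed
  moreover have "card (\<Union>k<M. G k) = (\<Sum>k<M. card (G k))"
  proof (rule card_UN_disjoint)
    show "\<forall>i\<in>{..<M}. finite (G i)" using finite_flows[OF E] by (simp add: G_def)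
    show "\<forall>i\<in>{..<M}. \<forall>j\<in>{..<M}. i \<noteq> j \<longrightarrow> G i \<inter> G j = {}"
    proof (intro ballI impI)
      fix i j :: nat assume "i \<noteq> j"
      have "m e = k" if "m \<in> G k" for m k using that by (auto simp: G_def)
      then show "G i \<inter> G j = {}" using \<open>i \<noteq> j\<close> by blast
    qed
  qed simp
  moreover have "card (G k) = card (flows E (\<lambda>v. x v - real k * ev e v))" for k
    unfolding G_def
  proof (intro card_image inj_onI)
    fix m m' assume mm: "m \<in> flows E (\<lambda>v. x v - real k * ev e v)" "m' \<in> flows E (\<lambda>v. x v - real k * ev e v)"
      and eq: "m(e := k) = m'(e := k)"
    have "m e = m' e" using flows_outside[OF mm(1) e(2)] flows_outside[OF mm(2) e(2)] by simp
    then have "(m(e := k))(e := m e) = (m'(e := k))(e := m' e)" using eq by simp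
    then show "m = m'" by simp
  qed
  ultimately show ?thesis by simp
qed

definition lattice :: "(nat \<Rightarrow> real) set" where
  "lattice = {x \<in> zero_sum n. \<forall>v. x v \<in> \<int>}"

lemma lattice_zero_sum: "x \<in> lattice \<Longrightarrow> x \<in> zero_sum n"
  by (simp add: lattice_def)

lemma lattice_diff: "x \<in> lattice \<Longrightarrow> e \<in> \<Phi> \<Longrightarrow> (\<lambda>v. x v - real k * ev e v) \<in> lattice"
  using zero_sum_diff_scale[OF _ ev_edge] by (auto simp: lattice_def) (auto simp: ev_def)

lemma co_linear:
  "co B b (\<lambda>v. x v + y v) = co B b x + co B b y"
  "co B b (\<lambda>v. x v - t * y v) = co B b x - t * co B b y"
  "co B b (\<lambda>v. t * x v) = t * co B b x"
  unfolding co_def by (simp_all only: lin_add lin_diff lin_scale)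

text \<open>Subtracting the constant \<open>pot B b n\<close> does not change the functional on
  zero-sum vectors and turns its coefficients into coordinates of the vectors
  \<open>ev (i, n)\<close>. The pairs \<open>(i, n)\<close> need not be edges, but unimodularity
  covers all pairs of vertices, so the coefficients are integers.\<close>

lemma co_eq_lin:
  assumes "B \<in> bases" "b \<in> B" "x \<in> zero_sum n"
  shows "co B b x = lin n (\<lambda>i. co B b (ev (i, n))) x"
proof -
  have "b \<in> \<Phi>" using assms bases_sub by blast
  then have n: "n \<in> {1..n}" using edge_range(1)[of b] by simp
  have "co B b x = (\<Sum>i=1..n. pot B b i * x i) - pot B b n * (\<Sum>i=1..n. x i)"
    using assms(3) by (simp add: co_def lin_def zero_sum_def)
  also have "\<dots> = (\<Sum>i=1..n. (pot B b i - pot B b n) * x i)"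
    by (simp add: sum_distrib_left left_diff_distrib sum_subtractf)
  also have "\<dots> = (\<Sum>i=1..n. co B b (ev (i, n)) * x i)"
    using lin_ev[of "(_, n)" n] n by (intro sum.cong refl) (simp add: co_def)
  finally show ?thesis by (simp add: lin_def)
qed

lemma co_ev_Ints:
  assumes "B \<in> bases" "b \<in> B" "i \<in> {1..n}"
  shows "co B b (ev (i, n)) \<in> \<int>"
  using co_unimodular[OF assms(1,2), of "(i, n)"] assms(3) by auto

lemma co_lattice:
  assumes "B \<in> bases" "b \<in> B" "x \<in> lattice"
  shows "co B b x \<in> \<int>"
  unfolding co_eq_lin[OF assms(1,2) lattice_zero_sum[OF assms(3)]] lin_def
  using assms(3) by (intro Ints_sum Ints_mult co_ev_Ints assms(1,2)) (auto simp: lattice_def)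

text \<open>Coordinates are unique, so a tree carries at most one flow; their integrality turns
  nonnegativity into existence.\<close>

lemma card_flows_basis:
  assumes B: "B \<in> bases" and x: "x \<in> lattice"
  shows "card (flows B x) = of_bool (\<forall>b\<in>B. 0 \<le> co B b x)"
proof (cases "\<forall>b\<in>B. 0 \<le> co B b x")
  case True
  define m where "m b = (if b \<in> B then nat \<lfloor>co B b x\<rfloor> else 0)" for b
  have m: "real (m b) = co B b x" if "b \<in> B" for b
    using True co_lattice[OF B that x] that by (auto simp: m_def elim!: Ints_cases)
  have "flows B x = {m}"
  proof (intro equalityI subsetI)
    fix m' assume m': "m' \<in> flows B x"
    have "co B b x = real (m' b)" if "b \<in> B" for b
      using co_unique[OF B that, of x "\<lambda>b. real (m' b)"] m' by (simp add: flows_def)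
    then have "m' b = m b" for b
      using m[of b] flows_outside[OF m', of b] by (cases "b \<in> B") (simp_all add: m_def)
    then show "m' \<in> {m}" by auto
  next
    have "(\<Sum>e\<in>B. real (m e) * ev e v) = x v" for v
      using co_expand[OF B lattice_zero_sum[OF x], of v] m by simp
    then show "m' \<in> flows B x" if "m' \<in> {m}" for m'
      using that by (simp add: flows_def m_def)
  qed
  then show ?thesis using True by simp
next
  case False
  have "m \<notin> flows B x" for m
  proof
    assume m: "m \<in> flows B x"
    have "co B b x = real (m b)" if "b \<in> B" for b
      using co_unique[OF B that, of x "\<lambda>b. real (m b)"] m by (simp add: flows_def)
    then show False using False by simp
  qed
  then have "flows B x = {}" by blast
  then show ?thesis using False by simp
qed

lemma polynomial_fun_co: "polynomial_fun n 1 (co B b)"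
  unfolding co_def lin_def by (intro polynomial_fun_sum polynomial_fun_cmult polynomial_fun_var)

section \<open>Generic vectors and the shifted expansion\<close>

definition generic :: "(nat \<Rightarrow> real) \<Rightarrow> bool" where
  "generic x \<longleftrightarrow> (\<forall>B\<in>bases. \<forall>b\<in>B. co B b x \<noteq> 0)"

text \<open>\<open>ev e\<close> has positive height, and so have the edges of \<open>B\<close>;
  hence not all coordinates can be nonpositive. Such a coordinate makes the line of points
  \<open>x - m * ev e\<close> leave the cone, as \<open>line_sum\<close> requires.\<close>

lemma exists_positive_coordinate:
  assumes B: "B \<in> bases" and e: "e \<in> \<Phi>"
  shows "\<exists>b\<in>B. co B b (ev e) = 1"
proof (rule ccontr)
  assume a: "\<not> (\<exists>b\<in>B. co B b (ev e) = 1)"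
  have "height (ev e) = (\<Sum>b\<in>B. co B b (ev e) * height (ev b))"
    unfolding height_def by (rule co_expand_lin[OF B ev_edge[OF e]])
  also have "\<dots> \<le> 0"
  proof (intro sum_nonpos mult_nonpos_nonneg)
    fix b assume b: "b \<in> B"
    show "co B b (ev e) \<le> 0"
      using co_unimodular[OF B b edge_range[OF e]] a b by auto
    show "0 \<le> height (ev b)" using height_edge[of b] bases_sub[OF B] b by fastforce
  qed
  finally show False using height_edge[OF e] by simp
qed

lemma lattice_add_generic_notin_Ints:
  assumes B: "B \<in> bases" "b \<in> B" and x: "x \<in> lattice"
    and y: "co B b y \<noteq> 0" "\<bar>co B b y\<bar> < 1"
  shows "co B b (\<lambda>v. x v + y v) \<notin> \<int>"
proof
  assume "co B b (\<lambda>v. x v + y v) \<in> \<int>"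
  then have "co B b y \<in> \<int>"
    using Ints_diff[of "co B b (\<lambda>v. x v + y v)" "co B b x"] co_lattice[OF B x] by (simp add: co_linear)
  then show False using y by (metis Ints_nonzero_abs_less1)
qed

text \<open>
  The infinitesimal shift by a generic \<open>y\<close> decides for each lattice point on a wall on which side
  it is counted, and makes the breakpoints along a line distinct. A breakpoint of the basis \<open>B\<close>
  in direction \<open>e\<close> occurs exactly when the shifted point lies in the cone of the basis obtained by
  exchanging the vanishing edge for \<open>e\<close>.
\<close>

lemma card_flows_expansion:
  assumes y: "y \<in> zero_sum n" "generic y" "\<And>B b. B \<in> bases \<Longrightarrow> b \<in> B \<Longrightarrow> \<bar>co B b y\<bar> < 1"
    and B0: "B0 \<in> bases" "\<And>b. b \<in> B0 \<Longrightarrow> 0 < co B0 b y"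
    and A: "A \<subseteq> \<Phi> - B0"
  shows "\<exists>p. (\<forall>B. polynomial_fun n (card A) (p B)) \<and>
    (\<forall>x\<in>lattice. real (card (flows (B0 \<union> A) x)) =
       (\<Sum>B\<in>bases. of_bool (\<forall>b\<in>B. 0 \<le> co B b (\<lambda>v. x v + y v)) * p B x))"
proof -
  have "finite A" using A finite_edges finite_subset by blast
  then show ?thesis using A
  proof (induction A)
    case empty
    let ?p = "\<lambda>B x. of_bool (B = B0) :: real"
    have "real (card (flows B0 x)) = (\<Sum>B\<in>bases. of_bool (\<forall>b\<in>B. 0 \<le> co B b (\<lambda>v. x v + y v)) * ?p B x)"
      if x: "x \<in> lattice" for x
    proof -
      \<comment> \<open>For an integer, nonnegativity does not change when a number strictly between
        0 and 1 is added. This is why the shift has to lie in the cone of \<open>B0\<close>.\<close>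
      have "0 \<le> co B0 b x \<longleftrightarrow> 0 \<le> co B0 b (\<lambda>v. x v + y v)" if b: "b \<in> B0" for b
      proof -
        obtain k where k: "co B0 b x = of_int k" using co_lattice[OF B0(1) b x] Ints_cases by blast
        have "real_of_int k \<le> -1" if "k < 0" using that by linarith
        then show ?thesis using B0(2)[OF b] y(3)[OF B0(1) b] unfolding co_linear k by (cases "k < 0") auto
      qed
      then have "real (card (flows B0 x)) = of_bool (\<forall>b\<in>B0. 0 \<le> co B0 b (\<lambda>v. x v + y v))"
        by (simp add: card_flows_basis[OF B0(1) x])
      also have "\<dots> = (\<Sum>B\<in>bases. if B = B0 then of_bool (\<forall>b\<in>B. 0 \<le> co B b (\<lambda>v. x v + y v)) else 0)"
        using B0(1) finite_bases by (simp only: sum.delta if_True)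
      also have "\<dots> = (\<Sum>B\<in>bases. of_bool (\<forall>b\<in>B. 0 \<le> co B b (\<lambda>v. x v + y v)) * ?p B x)"
        by (intro sum.cong refl) simp
      finally show ?thesis .
    qed
    then show ?case
      by (intro exI[of _ ?p]) (auto intro: polynomial_fun_const)
  next
    case (insert e A)
    then have e: "e \<in> \<Phi>" "e \<notin> B0 \<union> A" and E: "B0 \<union> A \<subseteq> \<Phi>"
      using bases_sub[OF B0(1)] by auto
    obtain p where p: "\<And>B. polynomial_fun n (card A) (p B)"
      "\<And>x. x \<in> lattice \<Longrightarrow> real (card (flows (B0 \<union> A) x)) =
         (\<Sum>B\<in>bases. of_bool (\<forall>b\<in>B. 0 \<le> co B b (\<lambda>v. x v + y v)) * p B x)"
      using insert by auto
    have "\<forall>B. \<exists>Q :: (nat \<Rightarrow> real) \<Rightarrow> real \<Rightarrow> real. (\<forall>x. Q x 0 = 0) \<and>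
      (\<forall>x t. Q x (t + 1) - Q x t = p B (\<lambda>i. x i - t * ev e i)) \<and>
      (\<forall>l. polynomial_fun n 1 l \<longrightarrow> polynomial_fun n (card A + 1) (\<lambda>x. Q x (l x)))"
      using polynomial_fun_antidifference[OF p(1), where w = "ev e"] by metis
    then obtain Q :: "(nat \<times> nat) set \<Rightarrow> (nat \<Rightarrow> real) \<Rightarrow> real \<Rightarrow> real" where Q: "\<And>B x. Q B x 0 = 0"
      "\<And>B x t. Q B x (t + 1) - Q B x t = p B (\<lambda>i. x i - t * ev e i)"
      "\<And>B l. polynomial_fun n 1 l \<Longrightarrow> polynomial_fun n (card A + 1) (\<lambda>x. Q B x (l x))"
      by metis
    define c where "c B b = co B b (ev e)" for B b
    define ind where "ind B x = (of_bool (\<forall>b\<in>B. 0 \<le> co B b (\<lambda>v. x v + y v)) :: real)" for B x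
    \<comment> \<open>On lattice points this is the rounded time of vanishing: a nonzero
      \<open>c B b\<close> is its own inverse, so the integer \<open>c B b * co B b x\<close> comes
      out of the ceiling and a constant remains.\<close>
    define l where "l B b x = c B b * co B b x + of_int \<lceil>co B b y / c B b\<rceil>" for B b x
    define R where "R = (\<lambda>(B, b) x. c B b * Q B x (l B b x))"
    define piv where "piv = (\<lambda>(B, b). insert e (B - {b}))"
    define S where "S = (SIGMA B:bases. {b\<in>B. c B b \<noteq> 0})"
    \<comment> \<open>Several pairs may exchange to the same tree; their contributions are
      collected.\<close>
    define p' where "p' B x = (\<Sum>s | s \<in> S \<and> piv s = B. R s x)" for B x
    have finS: "finite S" unfolding S_def
      using finite_bases bases_finite by (intro finite_SigmaI) auto
    have c_cases: "c B b \<in> {-1, 0, 1}" if "B \<in> bases" "b \<in> B" for B b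
      unfolding c_def by (rule co_unimodular[OF that edge_range[OF e(1)]])
    have "polynomial_fun n 1 (l B b)" for B b
      unfolding l_def
      by (intro polynomial_fun_add polynomial_fun_cmult polynomial_fun_co polynomial_fun_const)
    then have "polynomial_fun n (card A + 1) (R s)" for s
      unfolding R_def by (cases s) (simp add: polynomial_fun_cmult Q(3)[simplified])
    then have "polynomial_fun n (card A + 1) (p' B)" for B
      unfolding p'_def by (intro polynomial_fun_sum)
    moreover have "real (card (flows (insert e (B0 \<union> A)) x)) = (\<Sum>B\<in>bases. ind B x * p' B x)"
      if x: "x \<in> lattice" for x
    proof -
      define z where "z = (\<lambda>v. x v + y v)"
      have z: "z \<in> zero_sum n"
        unfolding z_def using x y(1) lattice_zero_sum zero_sum_add by blast
      have nonint: "co B b z \<notin> \<int>" if "B \<in> bases" "b \<in> B" for B b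
        unfolding z_def using lattice_add_generic_notin_Ints[OF that x] y that by (simp add: generic_def)
      define U where "U = Sigma bases (\<lambda>B. B)"
      have finU: "finite U" unfolding U_def
        using finite_bases bases_finite by (intro finite_SigmaI) auto
      \<comment> \<open>\<open>M\<close> exceeds the height, which cuts off the sum over flows, and
        every coordinate of \<open>z\<close>, which is the hypothesis \<open>large\<close> of
        \<open>line_sum\<close>.\<close>
      obtain M :: nat where M0: "\<bar>height x\<bar> + (\<Sum>(B, b)\<in>U. \<bar>co B b z\<bar>) < real M"
        using reals_Archimedean2 by blast
      have "\<bar>co B b z\<bar> \<le> (\<Sum>(B, b)\<in>U. \<bar>co B b z\<bar>)" if "B \<in> bases" "b \<in> B" for B b
        using member_le_sum[of "(B, b)" U "\<lambda>(B, b). \<bar>co B b z\<bar>"] finU that by (auto simp: U_def)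
      then have M: "co B b z \<le> real M" if "B \<in> bases" "b \<in> B" for B b
        using M0 that by fastforce
      have "0 \<le> (\<Sum>(B, b)\<in>U. \<bar>co B b z\<bar>)" by (intro sum_nonneg) auto
      then have hM: "height x < real M" using M0 by linarith
      have term_B: "(\<Sum>m<M. of_bool (\<forall>b\<in>B. 0 \<le> co B b z - real m * c B b) * p B (\<lambda>v. x v - real m * ev e v))
          = (\<Sum>b | b \<in> B \<and> c B b \<noteq> 0. ind (piv (B, b)) x * R (B, b) x)" if B: "B \<in> bases" for B
      proof -
        obtain u where u: "u \<in> B" "c B u = 1"
          using exists_positive_coordinate[OF B e(1)] by (auto simp: c_def)
        have "(\<Sum>m<M. of_bool (\<forall>b\<in>B. 0 \<le> co B b z - real m * c B b) * p B (\<lambda>v. x v - real m * ev e v))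
          = (\<Sum>b\<in>B. of_bool (0 \<le> co B b z / c B b \<and> (\<forall>b'\<in>B - {b}. 0 \<le> co B b' z - co B b z / c B b * c B b'))
              * (c B b * Q B x (of_int \<lceil>co B b z / c B b\<rceil>)))"
        proof (rule line_sum)
          show "co B b' z - co B b z / c B b * c B b' \<noteq> 0"
            if b: "b \<in> B" "b' \<in> B" "b \<noteq> b'" "c B b \<noteq> 0" for b b'
          proof -
            note P = pivot[OF B b(1) e(1) b(4)[unfolded c_def]]
            \<comment> \<open>The difference in question is the \<open>b'\<close> coordinate of
              \<open>z\<close> in the exchanged basis, which is not even an integer.\<close>
            have "co (insert e (B - {b})) b' z \<notin> \<int>"
              using nonint[OF P(1), of b'] b by blast
            then show ?thesis using P(3)[OF z, of b'] b unfolding c_def by force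
          qed
        qed (use B u Q nonint M bases_finite c_cases in auto)
        also have "\<dots> = (\<Sum>b\<in>B. if c B b \<noteq> 0 then ind (piv (B, b)) x * R (B, b) x else 0)"
        proof (intro sum.cong refl)
          fix b assume b: "b \<in> B"
          show "of_bool (0 \<le> co B b z / c B b \<and> (\<forall>b'\<in>B - {b}. 0 \<le> co B b' z - co B b z / c B b * c B b'))
              * (c B b * Q B x (of_int \<lceil>co B b z / c B b\<rceil>))
            = (if c B b \<noteq> 0 then ind (piv (B, b)) x * R (B, b) x else 0)"
          proof (cases "c B b = 0")
            case False
            note P = pivot[OF B b e(1) False[unfolded c_def]]
            have "ind (piv (B, b)) x
                = of_bool (0 \<le> co B b z / c B b \<and> (\<forall>b'\<in>B - {b}. 0 \<le> co B b' z - co B b z / c B b * c B b'))"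
              unfolding ind_def piv_def z_def[symmetric] c_def using P(2,3)[OF z] by simp
            moreover have "of_int \<lceil>co B b z / c B b\<rceil> = l B b x"
            proof -
              have "co B b x \<in> \<int>" "c B b \<in> {-1, 1}"
                using co_lattice[OF B b x] c_cases[OF B b] False by auto
              then have "c B b * co B b x \<in> \<int>" by auto
              then obtain k where k: "c B b * co B b x = of_int k" by (rule Ints_cases)
              have "co B b z / c B b = c B b * co B b x + co B b y / c B b"
                unfolding z_def co_linear using \<open>c B b \<in> {-1, 1}\<close> by auto
              moreover have "\<lceil>of_int k + co B b y / c B b\<rceil> = k + \<lceil>co B b y / c B b\<rceil>"
                using ceiling_add_of_int[of "co B b y / c B b" k] by (simp add: add.commute)
              ultimately show ?thesis unfolding l_def k by simp
            qed
            ultimately show ?thesis using False by (simp add: R_def)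
          qed simp
        qed
        also have "\<dots> = (\<Sum>b | b \<in> B \<and> c B b \<noteq> 0. ind (piv (B, b)) x * R (B, b) x)"
          by (rule sum.inter_filter[OF bases_finite[OF B], symmetric])
        finally show ?thesis .
      qed
      have "real (card (flows (insert e (B0 \<union> A)) x))
          = (\<Sum>m<M. real (card (flows (B0 \<union> A) (\<lambda>v. x v - real m * ev e v))))"
        unfolding card_flows_insert[OF E e hM] by simp
      also have "\<dots> = (\<Sum>m<M. \<Sum>B\<in>bases. of_bool (\<forall>b\<in>B. 0 \<le> co B b z - real m * c B b) *
          p B (\<lambda>v. x v - real m * ev e v))"
      proof (rule sum.cong[OF refl])
        fix m
        have "(\<lambda>v. x v - real m * ev e v + y v) = (\<lambda>v. z v - real m * ev e v)"
          by (auto simp: z_def)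
        then show "real (card (flows (B0 \<union> A) (\<lambda>v. x v - real m * ev e v)))
          = (\<Sum>B\<in>bases. of_bool (\<forall>b\<in>B. 0 \<le> co B b z - real m * c B b) * p B (\<lambda>v. x v - real m * ev e v))"
          unfolding p(2)[OF lattice_diff[OF x e(1)]] c_def by (simp only: co_linear)
      qed
      also have "\<dots> = (\<Sum>B\<in>bases. \<Sum>m<M. of_bool (\<forall>b\<in>B. 0 \<le> co B b z - real m * c B b) *
          p B (\<lambda>v. x v - real m * ev e v))"
        by (rule sum.swap)
      also have "\<dots> = (\<Sum>B\<in>bases. \<Sum>b | b \<in> B \<and> c B b \<noteq> 0. ind (piv (B, b)) x * R (B, b) x)"
        by (intro sum.cong refl) (rule term_B)
      also have "\<dots> = (\<Sum>s\<in>S. ind (piv s) x * R s x)"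
        unfolding S_def using finite_bases bases_finite
        by (subst sum.Sigma) (auto intro!: sum.cong)
      also have "\<dots> = (\<Sum>B\<in>bases. \<Sum>s | s \<in> S \<and> piv s = B. ind (piv s) x * R s x)"
      proof (rule sum.group[symmetric, OF finS finite_bases])
        show "piv ` S \<subseteq> bases"
        proof (rule image_subsetI)
          fix s assume "s \<in> S"
          then obtain B b where "s = (B, b)" "B \<in> bases" "b \<in> B" "co B b (ev e) \<noteq> 0"
            by (auto simp: S_def c_def)
          then show "piv s \<in> bases" using pivot(1)[OF _ _ e(1)] by (simp add: piv_def)
        qed
      qed
      also have "\<dots> = (\<Sum>B\<in>bases. ind B x * p' B x)"
        unfolding p'_def by (simp add: sum_distrib_left)
      finally show ?thesis .
    qed
    ultimately show ?case
      unfolding ind_def using insert(1,2) by (intro exI[of _ p']) simp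
  qed
qed

section \<open>Polynomiality on closed cells, growth, and generic points\<close>

definition compatible :: "(nat \<Rightarrow> real) \<Rightarrow> (nat \<Rightarrow> real) \<Rightarrow> bool" where
  "compatible y x \<longleftrightarrow> (\<forall>B\<in>bases. \<forall>b\<in>B. 0 \<le> co B b x * co B b y)"

text \<open>For \<open>x\<close> compatible with \<open>y\<close>, adding a positive multiple of
  \<open>y\<close> makes the sign of every coordinate that of \<open>y\<close>, even when
  \<open>x\<close> lies on a wall. All indicators in the expansion thus become constants.\<close>

lemma card_flows_polynomial:
  assumes y: "y \<in> zero_sum n" "generic y" and B0: "B0 \<in> bases" "\<And>b. b \<in> B0 \<Longrightarrow> 0 < co B0 b y"
  obtains f where "polynomial_fun n (card \<Phi> - (n - 1)) f"
    "\<And>x. x \<in> lattice \<Longrightarrow> compatible y x \<Longrightarrow> real (card (flows \<Phi> x)) = f x"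
proof -
  define U where "U = Sigma bases (\<lambda>B. B)"
  have finU: "finite U" unfolding U_def
    using finite_bases bases_finite by (intro finite_SigmaI) auto
  \<comment> \<open>Scaling keeps all signs and makes every coordinate of \<open>y\<close> smaller
    than 1 in absolute value; the extra 1 gives strictness and prevents division by 0.\<close>
  define s where "s = 1 / (1 + (\<Sum>(B, b)\<in>U. \<bar>co B b y\<bar>))"
  have nonneg: "0 \<le> (\<Sum>(B, b)\<in>U. \<bar>co B b y\<bar>)" by (intro sum_nonneg) auto
  then have s: "0 < s" by (simp add: s_def)
  define y' where "y' = (\<lambda>v. s * y v)"
  have y': "co B b y' = s * co B b y" for B b unfolding y'_def by (rule co_linear)
  have small: "\<bar>co B b y'\<bar> < 1" if "B \<in> bases" "b \<in> B" for B b
  proof -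
    have "\<bar>co B b y\<bar> \<le> (\<Sum>(B, b)\<in>U. \<bar>co B b y\<bar>)"
      using member_le_sum[of "(B, b)" U "\<lambda>(B, b). \<bar>co B b y\<bar>"] finU that by (auto simp: U_def)
    then show ?thesis using nonneg unfolding y' s_def by (simp add: abs_mult field_simps)
  qed
  have "\<exists>p. (\<forall>B. polynomial_fun n (card (\<Phi> - B0)) (p B)) \<and>
    (\<forall>x\<in>lattice. real (card (flows (B0 \<union> (\<Phi> - B0)) x)) =
       (\<Sum>B\<in>bases. of_bool (\<forall>b\<in>B. 0 \<le> co B b (\<lambda>v. x v + y' v)) * p B x))"
  proof (rule card_flows_expansion)
    show "y' \<in> zero_sum n" unfolding y'_def using y(1) by (rule zero_sum_scale)
    show "generic y'" using y(2) s by (simp add: generic_def y')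
  qed (use small B0 s in \<open>auto simp: y'\<close>)
  moreover have "B0 \<union> (\<Phi> - B0) = \<Phi>" "card (\<Phi> - B0) = card \<Phi> - (n - 1)"
    using bases_sub[OF B0(1)] bases_finite[OF B0(1)] bases_card[OF B0(1)] by (auto simp: card_Diff_subset)
  ultimately obtain p where p: "\<And>B. polynomial_fun n (card \<Phi> - (n - 1)) (p B)"
    "\<And>x. x \<in> lattice \<Longrightarrow> real (card (flows \<Phi> x)) =
       (\<Sum>B\<in>bases. of_bool (\<forall>b\<in>B. 0 \<le> co B b (\<lambda>v. x v + y' v)) * p B x)"
    by auto
  show thesis
  proof (rule that)
    show "polynomial_fun n (card \<Phi> - (n - 1)) (\<lambda>x. \<Sum>B\<in>bases. of_bool (\<forall>b\<in>B. 0 \<le> co B b y) * p B x)"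
      by (intro polynomial_fun_sum polynomial_fun_cmult p)
    fix x assume x: "x \<in> lattice" "compatible y x"
    have "0 \<le> co B b (\<lambda>v. x v + y' v) \<longleftrightarrow> 0 \<le> co B b y" if "B \<in> bases" "b \<in> B" for B b
    proof -
      have "0 \<le> co B b x * co B b y" "co B b y \<noteq> 0"
        using x(2) y(2) that by (auto simp: compatible_def generic_def)
      moreover have "0 \<le> co B b x + s * co B b y \<longleftrightarrow> 0 \<le> co B b y"
      proof (cases "0 < co B b y")
        case True
        then have "0 \<le> co B b x" using calculation by (simp add: zero_le_mult_iff)
        then show ?thesis using True s by simp
      next
        case False
        then have "co B b x \<le> 0" "co B b y < 0" using calculation by (auto simp: zero_le_mult_iff)
        then show ?thesis using mult_pos_neg[OF s, of "co B b y"] by linarith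
      qed
      ultimately show ?thesis by (simp add: co_linear y')
    qed
    then show "real (card (flows \<Phi> x)) = (\<Sum>B\<in>bases. of_bool (\<forall>b\<in>B. 0 \<le> co B b y) * p B x)"
      unfolding p(2)[OF x(1)] by simp
  qed
qed

text \<open>On the edges outside the tree any values up to \<open>k\<close> may be chosen, and the
  tree edges compensate. A tree edge given \<open>k * card A\<close> in advance absorbs
  \<open>card A\<close> corrections of size at most \<open>k\<close> and stays nonnegative.\<close>

lemma card_flows_growth:
  assumes B0: "B0 \<in> bases"
  obtains t where "\<And>b. 0 \<le> t b" "(\<lambda>v. \<Sum>b\<in>\<Phi>. t b * ev b v) \<in> lattice"
    "\<And>k::nat. (k + 1) ^ (card \<Phi> - (n - 1)) \<le> card (flows \<Phi> (\<lambda>v. real k * (\<Sum>b\<in>\<Phi>. t b * ev b v)))"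
proof -
  define A where "A = \<Phi> - B0"
  define t where "t b = (if b \<in> B0 then real (card A) else 0)" for b
  have fin: "finite B0" "finite A" and sub: "B0 \<subseteq> \<Phi>"
    using B0 bases_finite bases_sub finite_edges by (auto simp: A_def)
  have cardA: "card A = card \<Phi> - (n - 1)"
    unfolding A_def using card_Diff_subset[OF fin(1) sub] bases_card[OF B0] by simp
  have split: "sum g \<Phi> = sum g B0 + sum g A" for g :: "nat \<times> nat \<Rightarrow> real"
    unfolding A_def using sum.subset_diff[OF sub finite_edges, of g] by simp
  have t: "(\<Sum>b\<in>\<Phi>. t b * ev b v) = (\<Sum>b\<in>B0. real (card A) * ev b v)" for v
    unfolding split by (simp add: t_def A_def)
  have coA: "co B0 b (ev e) \<in> {-1, 0, 1}" if "b \<in> B0" "e \<in> A" for b e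
    using co_unimodular[OF B0 that(1) edge_range[of e]] that(2) by (simp add: A_def)
  show thesis
  proof (rule that)
    show "0 \<le> t b" for b by (simp add: t_def)
    have "(\<lambda>v. \<Sum>b\<in>\<Phi>. t b * ev b v) \<in> zero_sum n"
      by (rule zero_sum_sum) (rule ev_edge)
    moreover have "(\<Sum>b\<in>\<Phi>. t b * ev b v) \<in> \<int>" for v
      by (auto simp: t_def ev_def intro!: Ints_sum)
    ultimately show "(\<lambda>v. \<Sum>b\<in>\<Phi>. t b * ev b v) \<in> lattice" by (simp add: lattice_def)
    fix k :: nat
    \<comment> \<open>The flow left for the tree edge \<open>b\<close> once \<open>f\<close> is
      prescribed outside the tree.\<close>
    define r where "r f b = real k * real (card A) - (\<Sum>e\<in>A. real (f e) * co B0 b (ev e))"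
      for f :: "nat \<times> nat \<Rightarrow> nat" and b
    define m where "m f e = (if e \<in> B0 then nat \<lfloor>r f e\<rfloor> else if e \<in> A then f e else 0)"
      for f :: "nat \<times> nat \<Rightarrow> nat" and e
    let ?F = "A \<rightarrow>\<^sub>E {..k}"
    have r: "real (m f b) = r f b" if f: "f \<in> ?F" and b: "b \<in> B0" for f b
    proof -
      have "r f b \<in> \<int>"
        unfolding r_def using coA[OF b] by (intro Ints_diff Ints_mult Ints_sum) (auto, force)
      moreover have "(\<Sum>e\<in>A. real (f e) * co B0 b (ev e)) \<le> (\<Sum>e\<in>A. real k)"
      proof (rule sum_mono)
        fix e assume e: "e \<in> A"
        then have "real (f e) \<le> real k" using f by auto
        moreover have "real (f e) * co B0 b (ev e) \<le> real (f e)"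
          using coA[OF b e] by auto
        ultimately show "real (f e) * co B0 b (ev e) \<le> real k" by linarith
      qed
      then have "0 \<le> r f b" by (simp add: r_def mult.commute)
      ultimately show ?thesis using b by (auto simp: m_def elim!: Ints_cases)
    qed
    have "m f \<in> flows \<Phi> (\<lambda>v. real k * (\<Sum>b\<in>\<Phi>. t b * ev b v))" if f: "f \<in> ?F" for f
    proof -
      have "(\<Sum>e\<in>\<Phi>. real (m f e) * ev e v) = real k * (\<Sum>b\<in>\<Phi>. t b * ev b v)" for v
      proof -
        have 1: "(\<Sum>e\<in>A. real (m f e) * ev e v)
            = (\<Sum>e\<in>A. \<Sum>b\<in>B0. real (f e) * (co B0 b (ev e) * ev b v))"
        proof (rule sum.cong[OF refl])
          fix e assume e: "e \<in> A"
          then have "ev e v = (\<Sum>b\<in>B0. co B0 b (ev e) * ev b v)"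
            using co_expand[OF B0 ev_edge] by (simp add: A_def)
          then show "real (m f e) * ev e v = (\<Sum>b\<in>B0. real (f e) * (co B0 b (ev e) * ev b v))"
            using e by (simp add: m_def A_def sum_distrib_left)
        qed
        have "(\<Sum>e\<in>B0. real (m f e) * ev e v) = (\<Sum>b\<in>B0. r f b * ev b v)"
          by (intro sum.cong refl) (simp add: r[OF f])
        also have "\<dots> = (\<Sum>b\<in>B0. real k * (real (card A) * ev b v)
            - (\<Sum>e\<in>A. real (f e) * (co B0 b (ev e) * ev b v)))"
          unfolding r_def by (intro sum.cong refl) (simp add: left_diff_distrib sum_distrib_right mult.assoc)
        also have "\<dots> = real k * (\<Sum>b\<in>\<Phi>. t b * ev b v) - (\<Sum>e\<in>A. real (m f e) * ev e v)"
          unfolding t 1 sum_subtractf sum_distrib_left by (subst (2) sum.swap) simp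
        finally show ?thesis unfolding split[of "\<lambda>e. real (m f e) * ev e v"] by simp
      qed
      moreover have "m f e = 0" if "e \<notin> \<Phi>" for e
        using that sub by (auto simp: m_def A_def)
      ultimately show ?thesis by (simp add: flows_def)
    qed
    moreover have "inj_on m ?F"
    proof (rule inj_onI)
      fix f g assume fg: "f \<in> ?F" "g \<in> ?F" "m f = m g"
      show "f = g"
      proof (rule PiE_ext[OF fg(1,2)])
        fix e assume "e \<in> A"
        then show "f e = g e" using fun_cong[OF fg(3), of e] by (simp add: m_def A_def)
      qed
    qed
    ultimately have "card ?F \<le> card (flows \<Phi> (\<lambda>v. real k * (\<Sum>b\<in>\<Phi>. t b * ev b v)))"
      using finite_flows[of \<Phi>] by (intro card_inj_on_le[of m]) auto
    moreover have "card ?F = (k + 1) ^ card A"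
      using card_funcsetE[OF fin(2), of "{..k}"] by simp
    ultimately show "(k + 1) ^ (card \<Phi> - (n - 1)) \<le> card (flows \<Phi> (\<lambda>v. real k * (\<Sum>b\<in>\<Phi>. t b * ev b v)))"
      by (simp add: cardA)
  qed
qed

text \<open>Take a tree that shares as many edges as possible with the support \<open>T\<close> of
  \<open>t\<close>. If it had an edge \<open>b\<close> outside \<open>T\<close>, maximality would
  forbid every exchange of \<open>b\<close> for an edge of \<open>T\<close>, so the \<open>b\<close>
  coordinate of \<open>y\<close> would vanish, against genericity. Hence the tree lies in
  \<open>T\<close>, and the bound on \<open>card T\<close> forces equality.\<close>

lemma generic_in_basis_cone:
  assumes ne: "bases \<noteq> {}" and y: "generic y"
    and t: "\<And>e. 0 \<le> t e" "\<And>v. y v = (\<Sum>e\<in>\<Phi>. t e * ev e v)"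
    and card: "card {e \<in> \<Phi>. t e \<noteq> 0} \<le> n - 1"
  obtains B where "B \<in> bases" "\<And>b. b \<in> B \<Longrightarrow> 0 < co B b y"
proof -
  define T where "T = {e \<in> \<Phi>. t e \<noteq> 0}"
  have finT: "finite T" using finite_edges by (simp add: T_def)
  obtain B where B: "B \<in> bases" "card (B \<inter> T) = Max ((\<lambda>B. card (B \<inter> T)) ` bases)"
    using obtains_MAX[OF finite_bases ne, of "\<lambda>B. card (B \<inter> T)"] by metis
  have max: "card (B' \<inter> T) \<le> card (B \<inter> T)" if "B' \<in> bases" for B'
    unfolding B(2) using finite_bases that by (intro Max_ge) auto
  note B = B(1)
  have yT: "y v = (\<Sum>e\<in>T. t e * ev e v)" for v
    unfolding t(2) T_def by (rule sum.mono_neutral_right) (use finite_edges in auto)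
  have zero: "co B b (ev e) = 0" if e: "e \<in> T - B" and b: "b \<in> B - T" for e b
  proof (rule ccontr)
    assume nz: "co B b (ev e) \<noteq> 0"
    have "insert e (B - {b}) \<in> bases"
      using pivot(1)[OF B _ _ nz] e b by (simp add: T_def)
    moreover have "insert e (B - {b}) \<inter> T = insert e (B \<inter> T)" using e b by auto
    moreover have "card (insert e (B \<inter> T)) = Suc (card (B \<inter> T))" using e finT by simp
    ultimately show False using max by fastforce
  qed
  have "b \<in> T" if b: "b \<in> B" for b
  proof (rule ccontr)
    assume nT: "b \<notin> T"
    have "y = (\<lambda>v. \<Sum>e\<in>T. t e * ev e v)" using yT by blast
    then have "co B b y = co B b (\<lambda>v. \<Sum>e\<in>T. t e * ev e v)" by (rule arg_cong)
    also have "\<dots> = (\<Sum>e\<in>T. t e * co B b (ev e))" unfolding co_def by (rule lin_sum)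
    also have "\<dots> = 0"
    proof (rule sum.neutral, rule ballI)
      fix e assume e: "e \<in> T"
      have "co B b (ev e) = 0"
      proof (cases "e \<in> B")
        case True
        then show ?thesis using co_ev[OF B b True] e nT by auto
      next
        case False
        then show ?thesis using zero[of e b] e b nT by blast
      qed
      then show "t e * co B b (ev e) = 0" by simp
    qed
    finally show False using y B b by (auto simp: generic_def)
  qed
  then have "B = T" using card_subset_eq[OF finT] bases_card[OF B] card
    by (metis T_def card_mono finT le_antisym subsetI)
  then have "co B b y = t b" if "b \<in> B" for b
    using co_unique[OF B that, of y t] yT by simp
  moreover have "0 < t b" if "b \<in> T" for b
    using that t(1)[of b] by (simp add: T_def)
  ultimately show thesis using that B \<open>B = T\<close> by simp
qed

text \<open>Put weights \<open>s ^ k\<close> on the edges of \<open>B0\<close>. Every tree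
  coordinate is then a nonzero polynomial in \<open>s\<close>, and finitely many such polynomials
  have a common non-root in \<open>{0<..<1}\<close>.\<close>

lemma exists_generic:
  assumes B0: "B0 \<in> bases"
  obtains t where "\<And>e. 0 \<le> t e" "generic (\<lambda>v. \<Sum>e\<in>\<Phi>. t e * ev e v)"
proof -
  have fin: "finite B0" and sub: "B0 \<subseteq> \<Phi>" using B0 bases_finite bases_sub by auto
  obtain f where f: "bij_betw f {0..<card B0} B0" using ex_bij_betw_nat_finite[OF fin] by blast
  define g where "g = inv_into {0..<card B0} f"
  have g: "bij_betw g B0 {0..<card B0}" unfolding g_def using f by (rule bij_betw_inv_into)
  define U where "U = Sigma bases (\<lambda>B. B)"
  have finU: "finite U" unfolding U_def
    using finite_bases bases_finite by (intro finite_SigmaI) auto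
  define a where "a B b k = (if k < card B0 then co B b (ev (f k)) else 0)" for B b k
  have eval: "(\<Sum>b0\<in>B0. s ^ g b0 * co B b (ev b0)) = (\<Sum>k\<le>card B0. a B b k * s ^ k)" for B b s
  proof -
    have "(\<Sum>b0\<in>B0. s ^ g b0 * co B b (ev b0)) = (\<Sum>k\<in>{0..<card B0}. s ^ g (f k) * co B b (ev (f k)))"
      by (rule sum.reindex_bij_betw[OF f, symmetric])
    also have "\<dots> = (\<Sum>k\<in>{0..<card B0}. a B b k * s ^ k)"
      using f by (intro sum.cong refl) (simp add: g_def bij_betw_def a_def)
    also have "\<dots> = (\<Sum>k\<le>card B0. a B b k * s ^ k)"
      by (rule sum.mono_neutral_left) (auto simp: a_def)
    finally show ?thesis .
  qed
  have "finite {s. (\<Sum>k\<le>card B0. a B b k * s ^ k) = 0}" if B: "B \<in> bases" "b \<in> B" for B b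
  proof (rule ccontr)
    assume "infinite {s. (\<Sum>k\<le>card B0. a B b k * s ^ k) = 0}"
    then have a0: "a B b k = 0" if "k \<le> card B0" for k
      using polyfun_finite_roots[of "a B b" "card B0"] that by blast
    have co0: "co B b (ev b0) = 0" if "b0 \<in> B0" for b0
    proof -
      have "b0 \<in> f ` {0..<card B0}" using f that by (simp add: bij_betw_def)
      then obtain k where "k < card B0" "f k = b0" by auto
      then show ?thesis using a0[of k] by (simp add: a_def)
    qed
    \<comment> \<open>If all coefficients vanished, the coordinate functional would vanish on the
      span of \<open>B0\<close>, in particular at \<open>ev b\<close>, where it is 1.\<close>
    have "co B b (ev b) = (\<Sum>b0\<in>B0. co B0 b0 (ev b) * co B b (ev b0))"
      unfolding co_def[of B] by (rule co_expand_lin[OF B0 ev_edge]) (use bases_sub[OF B(1)] B in auto)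
    then show False using co_ev[OF B B(2)] co0 by simp
  qed
  then have "finite (\<Union>(B, b)\<in>U. {s. (\<Sum>k\<le>card B0. a B b k * s ^ k) = 0})"
    using finU by (auto simp: U_def)
  moreover have "infinite {0<..<1::real}" by simp
  ultimately obtain s where s: "s \<in> {0<..<1}" "s \<notin> (\<Union>(B, b)\<in>U. {s. (\<Sum>k\<le>card B0. a B b k * s ^ k) = 0})"
    by (meson finite_subset subsetI)
  define t where "t b = (if b \<in> B0 then s ^ g b else 0)" for b
  show thesis
  proof (rule that)
    show "0 \<le> t e" for e using s(1) by (simp add: t_def)
    have "(\<Sum>e\<in>\<Phi>. t e * ev e v) = (\<Sum>e\<in>B0. s ^ g e * ev e v)" for v
      by (rule sum.mono_neutral_cong_right) (use finite_edges sub in \<open>auto simp: t_def\<close>)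
    moreover have "co B b (\<lambda>v. \<Sum>e\<in>B0. s ^ g e * ev e v) \<noteq> 0" if "B \<in> bases" "b \<in> B" for B b
    proof -
      have "co B b (\<lambda>v. \<Sum>e\<in>B0. s ^ g e * ev e v) = (\<Sum>b0\<in>B0. s ^ g b0 * co B b (ev b0))"
        unfolding co_def by (rule lin_sum)
      then show ?thesis unfolding eval using s(2) that by (auto simp: U_def)
    qed
    ultimately show "generic (\<lambda>v. \<Sum>e\<in>\<Phi>. t e * ev e v)" by (simp add: generic_def)
  qed
qed

end

subsection \<open>Polynomials on integral cones\<close>

lemma polyhedral_cone_closed:
  assumes "polyhedral_cone n C"
  shows "closed C"
proof -
  obtain L where L: "C = {x \<in> vecs n. \<forall>a\<in>L. 0 \<le> (\<Sum>i=1..n. a i * x i)}"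
    using assms unfolding polyhedral_cone_def by blast
  have c: "continuous_on UNIV (\<lambda>x::nat \<Rightarrow> real. x i)" for i
    by (rule continuous_on_product_coordinates)
  have "C = (\<Inter>i\<in>- {1..n}. {x. x i = 0}) \<inter> (\<Inter>a\<in>L. {x. 0 \<le> (\<Sum>i=1..n. a i * x i)})"
    unfolding L vecs_def by auto
  moreover have "closed {x::nat \<Rightarrow> real. x i = 0}" for i
    by (intro closed_Collect_eq c continuous_on_const)
  moreover have "closed {x::nat \<Rightarrow> real. 0 \<le> (\<Sum>i=1..n. a i * x i)}" for a
    by (intro closed_Collect_le continuous_on_sum continuous_on_mult c continuous_on_const)
  ultimately show ?thesis by (auto intro!: closed_Int closed_INT)
qed

text \<open>The pasting lemma for finitely many closed pieces; agreement on overlaps is contained in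
  \<open>F\<close> being a function.\<close>

lemma piecewise_polynomial_continuous_on:
  assumes "piecewise_polynomial_on n d D F"
  shows "continuous_on D F"
proof -
  obtain \<C> where C: "finite \<C>" "\<Union>\<C> = D"
    "\<And>C. C \<in> \<C> \<Longrightarrow> polyhedral_cone n C \<and> (\<exists>f. polynomial_fun n d f \<and> (\<forall>x\<in>C. F x = f x))"
    using assms unfolding piecewise_polynomial_on_def by blast
  have "continuous_on (\<Union>C\<in>\<C>. C) F"
  proof (rule continuous_on_closed_Union[OF C(1)])
    fix C assume "C \<in> \<C>"
    then obtain f where f: "polyhedral_cone n C" "polynomial_fun n d f" "\<And>x. x \<in> C \<Longrightarrow> F x = f x"
      using C(3) by blast
    show "closed C" using f(1) by (rule polyhedral_cone_closed)
    show "continuous_on C F"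
      using polynomial_fun_continuous[OF f(2)] f(3) continuous_on_cong[of C C F f] by simp
  qed
  then show ?thesis using C(2) by simp
qed

lemma lin_scale_coeff: "lin n (\<lambda>i. t * h i) x = t * lin n h x"
  unfolding lin_def by (simp add: sum_distrib_left mult.assoc)

text \<open>
  Simultaneous Diophantine approximation of a point of an integral cone yields lattice points that
  violate each defining inequality by less than 1, hence not at all.
\<close>

lemma polynomial_fun_eq_0_on_cone:
  assumes L: "finite L" "\<And>h i. h \<in> L \<Longrightarrow> i \<in> {1..n} \<Longrightarrow> h i \<in> \<int>"
    and x: "x \<in> vecs n" "\<And>h. h \<in> L \<Longrightarrow> 0 \<le> lin n h x"
    and g: "polynomial_fun n d g"
    and z: "\<And>z. z \<in> vecs n \<Longrightarrow> (\<And>i. z i \<in> \<int>) \<Longrightarrow> (\<And>h. h \<in> L \<Longrightarrow> 0 \<le> lin n h z) \<Longrightarrow> g z = 0"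
  shows "g x = 0"
proof -
  define W where "W = (\<Sum>h\<in>L. \<Sum>i=1..n. \<bar>h i\<bar>)"
  have W: "(\<Sum>i=1..n. \<bar>h i\<bar>) \<le> W" if "h \<in> L" for h
    unfolding W_def by (rule member_le_sum[OF that]) (auto intro: sum_nonneg L(1))
  have "\<exists>z. (\<forall>i\<in>{1..n}. \<bar>z i - x i\<bar> \<le> 1 / real (N + 1)) \<and> g z = 0" for N :: nat
  proof -
    \<comment> \<open>\<open>W < real M\<close> keeps the error in every inequality below 1; the
      second bound gives the required precision.\<close>
    obtain M :: nat where M: "W < real M" "real (N + 1) \<le> real M" "0 < M"
      using reals_Archimedean2[of "\<bar>W\<bar> + real (N + 1)"] by (metis (no_types) abs_ge_self abs_ge_zero
          add.commute add_increasing add_increasing2 le_less_trans less_imp_le not_less of_nat_0_le_iff of_nat_0_less_iff)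
    obtain q p where qp: "0 < q" "\<And>i. i < n \<Longrightarrow> \<bar>of_int q * x (Suc i) - of_int (p i)\<bar> < 1 / M"
      using Dirichlet_approx_simult[OF M(3), of n "\<lambda>i. x (Suc i)"] by metis
    define z where "z i = (if i \<in> {1..n} then real_of_int (p (i - 1)) else 0)" for i
    have zx: "\<bar>of_int q * x i - z i\<bar> < 1 / M" if "i \<in> {1..n}" for i
    proof -
      have "i - 1 < n" "Suc (i - 1) = i" using that by auto
      then show ?thesis using qp(2)[of "i - 1"] that by (simp add: z_def)
    qed
    have zi: "z i \<in> \<int>" for i by (simp add: z_def)
    have nonneg: "0 \<le> lin n h z" if h: "h \<in> L" for h
    proof -
      have "\<bar>of_int q * lin n h x - lin n h z\<bar> = \<bar>\<Sum>i=1..n. h i * (of_int q * x i - z i)\<bar>"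
        unfolding lin_def by (simp add: sum_distrib_left sum_subtractf right_diff_distrib mult_ac)
      also have "\<dots> \<le> (\<Sum>i=1..n. \<bar>h i\<bar> * (1 / M))"
      proof (rule order_trans[OF sum_abs], rule sum_mono)
        fix i assume "i \<in> {1..n}"
        then show "\<bar>h i * (of_int q * x i - z i)\<bar> \<le> \<bar>h i\<bar> * (1 / M)"
          using zx[of i] unfolding abs_mult by (intro mult_left_mono) auto
      qed
      also have "\<dots> = (\<Sum>i=1..n. \<bar>h i\<bar>) * (1 / M)" by (rule sum_distrib_right[symmetric])
      also have "\<dots> < 1" using W[OF h] M by (simp add: field_simps)
      finally have "of_int q * lin n h x - 1 < lin n h z" by linarith
      moreover have "0 \<le> of_int q * lin n h x" using x(2)[OF h] qp(1) by simp
      moreover have "lin n h z \<in> \<int>"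
        unfolding lin_def using L(2)[OF h] zi by (intro Ints_sum Ints_mult) auto
      then obtain k where "lin n h z = of_int k" by (rule Ints_cases)
      ultimately show ?thesis by simp
    qed
    \<comment> \<open>All multiples of \<open>z\<close> are lattice points of the cone, so
      \<open>g\<close> vanishes on the whole ray, in particular at \<open>z\<close> divided by
      \<open>q\<close>.\<close>
    have "g (\<lambda>i. real k * z i) = 0" for k
    proof (rule z)
      show "(\<lambda>i. real k * z i) \<in> vecs n" by (auto simp: vecs_def z_def)
      show "real k * z i \<in> \<int>" for i using zi by auto
      show "0 \<le> lin n h (\<lambda>i. real k * z i)" if "h \<in> L" for h
        using nonneg[OF that] by (simp add: lin_scale)
    qed
    then have g0: "g (\<lambda>i. (1 / of_int q) * z i) = 0" by (rule polynomial_fun_ray_eq_0[OF g])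
    have near: "\<bar>(1 / of_int q) * z i - x i\<bar> \<le> 1 / real (N + 1)" if i: "i \<in> {1..n}" for i
    proof -
      have q: "1 \<le> real_of_int q" using qp(1) by simp
      have "\<bar>(1 / of_int q) * z i - x i\<bar> = \<bar>of_int q * x i - z i\<bar> / of_int q"
        using q by (simp add: abs_if field_simps)
      also have "\<dots> \<le> \<bar>of_int q * x i - z i\<bar>" using q by (simp add: divide_le_eq mult_le_cancel_left1)
      also have "\<dots> \<le> 1 / real M" using zx[OF i] by simp
      also have "\<dots> \<le> 1 / real (N + 1)" using M(2) by (intro divide_left_mono) auto
      finally show ?thesis .
    qed
    show ?thesis
    proof (rule exI, rule conjI)
      show "g (\<lambda>i. (1 / of_int q) * z i) = 0" by (rule g0)
      show "\<forall>i\<in>{1..n}. \<bar>(1 / of_int q) * z i - x i\<bar> \<le> 1 / real (N + 1)"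
        using near by blast
    qed
  qed
  then obtain X where X: "\<And>N i. i \<in> {1..n} \<Longrightarrow> \<bar>X N i - x i\<bar> \<le> 1 / real (N + 1)" "\<And>N. g (X N) = 0"
    by metis
  have lim: "(\<lambda>N. X N i) \<longlonglongrightarrow> x i" if "i \<in> {1..n}" for i
  proof -
    have "norm (X N i - x i) \<le> inverse (real (Suc N))" for N
      using X(1)[OF that, of N] by (simp only: real_norm_def inverse_eq_divide Suc_eq_plus1)
    then have "(\<lambda>N. X N i - x i) \<longlonglongrightarrow> 0"
      by (rule Lim_null_comparison[OF always_eventually LIMSEQ_inverse_real_of_nat, OF allI])
    then show ?thesis by (rule LIM_zero_cancel)
  qed
  have "(\<lambda>N. g (X N)) \<longlonglongrightarrow> g x"
    using polynomial_fun_tendsto[where X = X and x = x and G = sequentially, OF g lim] .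
  then have "(\<lambda>N::nat. 0) \<longlonglongrightarrow> g x" unfolding X(2) .
  then show ?thesis by (simp add: LIMSEQ_const_iff)
qed

text \<open>Edges are regrouped by tail and head. Outside \<open>{1..n}\<close> both sides of the
  flow equation vanish, so quantifying over all vertices adds no condition.\<close>

lemma (in dag) kostant_eq_card_flows:
  assumes "\<gamma> \<in> vecs n"
  shows "kostant n \<Phi> \<gamma> = card (flows \<Phi> (\<lambda>i. real_of_int (\<gamma> i)))"
proof -
  have net: "(\<Sum>e\<in>\<Phi>. real (m e) * ev e v) = real_of_int
      ((\<Sum>j | (v, j) \<in> \<Phi>. int (m (v, j))) - (\<Sum>j | (j, v) \<in> \<Phi>. int (m (j, v))))" for m v
  proof -
    have 1: "(\<Sum>j | (v, j) \<in> \<Phi>. int (m (v, j))) = (\<Sum>e | e \<in> \<Phi> \<and> fst e = v. int (m e))"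
      by (rule sum.reindex_bij_witness[of _ snd "\<lambda>j. (v, j)"]) auto
    have 2: "(\<Sum>j | (j, v) \<in> \<Phi>. int (m (j, v))) = (\<Sum>e | e \<in> \<Phi> \<and> snd e = v. int (m e))"
      by (rule sum.reindex_bij_witness[of _ fst "\<lambda>j. (j, v)"]) auto
    have "(\<Sum>e\<in>\<Phi>. real (m e) * ev e v)
        = (\<Sum>e\<in>\<Phi>. (if fst e = v then real (m e) else 0) - (if snd e = v then real (m e) else 0))"
      by (intro sum.cong refl) (auto simp: ev_def)
    also have "\<dots> = (\<Sum>e | e \<in> \<Phi> \<and> fst e = v. real (m e)) - (\<Sum>e | e \<in> \<Phi> \<and> snd e = v. real (m e))"
      unfolding sum_subtractf by (simp only: sum.inter_filter[OF finite_edges])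
    finally show ?thesis unfolding 1 2 by simp
  qed
  have out: "(\<Sum>e\<in>\<Phi>. real (m e) * ev e v) = real_of_int (\<gamma> v)" if "v \<notin> {1..n}" for m :: "nat \<times> nat \<Rightarrow> nat" and v
  proof -
    have "ev e v = 0" if "e \<in> \<Phi>" for e
      using edge_range[OF that] \<open>v \<notin> {1..n}\<close> by (auto simp: ev_def)
    then show ?thesis using assms that by (simp add: vecs_def)
  qed
  have "(\<forall>i\<in>{1..n}. (\<Sum>j | (i, j) \<in> \<Phi>. int (m (i, j))) - (\<Sum>j | (j, i) \<in> \<Phi>. int (m (j, i))) = \<gamma> i)
      \<longleftrightarrow> (\<forall>v. (\<Sum>e\<in>\<Phi>. real (m e) * ev e v) = real_of_int (\<gamma> v))" (is "?L \<longleftrightarrow> ?R")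
    for m :: "nat \<times> nat \<Rightarrow> nat"
  proof
    assume L: ?L
    show ?R
    proof
      fix v show "(\<Sum>e\<in>\<Phi>. real (m e) * ev e v) = real_of_int (\<gamma> v)"
      proof (cases "v \<in> {1..n}")
        case True
        show ?thesis unfolding net bspec[OF L True] by (rule refl)
      next
        case False
        then show ?thesis by (rule out)
      qed
    qed
  next
    assume R: ?R
    show ?L
    proof
      fix i
      show "(\<Sum>j | (i, j) \<in> \<Phi>. int (m (i, j))) - (\<Sum>j | (j, i) \<in> \<Phi>. int (m (j, i))) = \<gamma> i"
        using spec[OF R, of i] unfolding net of_int_eq_iff .
    qed
  qed
  then show ?thesis unfolding kostant_def flows_def by simp
qed

section \<open>Edges and inequalities of a composition\<close>

lemma psum_0: "psum \<eta> 0 = 0"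
  and psum_length: "psum \<eta> (length \<eta>) = sum_list \<eta>"
  by (simp_all add: psum_def)

lemma psum_mono: "k \<le> l \<Longrightarrow> psum \<eta> k \<le> psum \<eta> l"
  by (metis psum_def le_iff_add le_add_same_cancel1 sum_list_append take_add zero_le)

lemma psum_le: "psum \<eta> k \<le> sum_list \<eta>"
  by (metis append_take_drop_id le_add1 psum_def sum_list_append)

text \<open>A new part receives edges from all old vertices, through the cut at
  \<open>length \<eta>\<close>; the cut at the new total has no vertex behind it and gives
  none.\<close>

lemma Phi_snoc: "Phi (\<eta> @ [a]) = Phi \<eta> \<union> {1..sum_list \<eta>} \<times> {sum_list \<eta> + 1..sum_list \<eta> + a}"
proof -
  have 1: "psum (\<eta> @ [a]) k = psum \<eta> k" if "k \<le> length \<eta>" for k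
    using that by (simp add: psum_def)
  have 2: "psum (\<eta> @ [a]) (Suc (length \<eta>)) = sum_list \<eta> + a"
    by (simp add: psum_def)
  show ?thesis
  proof (intro equalityI subsetI)
    fix e assume "e \<in> Phi (\<eta> @ [a])"
    then obtain i j k where e: "e = (i, j)" "k \<le> Suc (length \<eta>)" "1 \<le> i" "i \<le> psum (\<eta> @ [a]) k"
      "psum (\<eta> @ [a]) k < j" "j \<le> sum_list \<eta> + a" by (auto simp: Phi_def)
    have k: "k \<le> length \<eta>" using e 2 by (cases "k = Suc (length \<eta>)") auto
    show "e \<in> Phi \<eta> \<union> {1..sum_list \<eta>} \<times> {sum_list \<eta> + 1..sum_list \<eta> + a}"
    proof (cases "j \<le> sum_list \<eta>")
      case True
      then show ?thesis using e k 1[OF k] by (auto simp: Phi_def)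
    next
      case False
      then show ?thesis using e 1[OF k] psum_le[of \<eta> k] by auto
    qed
  next
    fix e assume "e \<in> Phi \<eta> \<union> {1..sum_list \<eta>} \<times> {sum_list \<eta> + 1..sum_list \<eta> + a}"
    then show "e \<in> Phi (\<eta> @ [a])"
    proof
      assume "e \<in> Phi \<eta>"
      then obtain i j k where "e = (i, j)" "k \<le> length \<eta>" "1 \<le> i" "i \<le> psum \<eta> k"
        "psum \<eta> k < j" "j \<le> sum_list \<eta>" by (auto simp: Phi_def)
      then show ?thesis using 1[of k] by (auto simp: Phi_def intro!: exI[of _ k])
    next
      assume "e \<in> {1..sum_list \<eta>} \<times> {sum_list \<eta> + 1..sum_list \<eta> + a}"
      then show ?thesis using 1[of "length \<eta>"] psum_length[of \<eta>]
        by (auto simp: Phi_def intro!: exI[of _ "length \<eta>"])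
    qed
  qed
qed

lemma dag_Phi: "dag (sum_list \<eta>) (Phi \<eta>)"
  by unfold_locales (auto simp: Phi_def)

lemma card_Phi: "card (Phi \<eta>) = (\<Sum>j<length \<eta>. \<Sum>i<j. \<eta> ! i * \<eta> ! j)"
proof (induction \<eta> rule: rev_induct)
  case Nil
  have "Phi [] = {}" by (auto simp: Phi_def)
  then show ?case by simp
next
  case (snoc a \<eta>)
  have "Phi \<eta> \<inter> {1..sum_list \<eta>} \<times> {sum_list \<eta> + 1..sum_list \<eta> + a} = {}"
    by (auto simp: Phi_def)
  then have "card (Phi (\<eta> @ [a])) = card (Phi \<eta>) + sum_list \<eta> * a"
    unfolding Phi_snoc using card_Un_disjoint[OF dag.finite_edges[OF dag_Phi]]
    by (simp add: card_cartesian_product)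
  also have "sum_list \<eta> = (\<Sum>i<length \<eta>. \<eta> ! i)"
    by (simp add: sum_list_sum_nth atLeast0LessThan)
  finally show ?case
    using snoc by (simp add: nth_append sum_distrib_right)
qed

text \<open>The index sets of the inequalities of \<open>Y\<close>. With a vertex each of them
  contains the tails of all edges into it, so the inequality says that the net outflow of the set is
  nonnegative.\<close>

definition Ysets :: "nat list \<Rightarrow> nat set set" where
  "Ysets \<eta> = {{1..psum \<eta> k} \<union> \<Omega> | k \<Omega>. k < length \<eta> \<and> \<Omega> \<subseteq> {psum \<eta> k + 1..psum \<eta> (k + 1)}}"

lemma Ysets_sub: "S \<in> Ysets \<eta> \<Longrightarrow> S \<subseteq> {1..sum_list \<eta>}"
proof -
  assume "S \<in> Ysets \<eta>"
  then obtain k \<Omega> where "S = {1..psum \<eta> k} \<union> \<Omega>" "\<Omega> \<subseteq> {psum \<eta> k + 1..psum \<eta> (k + 1)}"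
    by (auto simp: Ysets_def)
  then show ?thesis using psum_le[of \<eta> k] psum_le[of \<eta> "k + 1"] by fastforce
qed

lemma finite_Ysets: "finite (Ysets \<eta>)"
  by (rule finite_subset[of _ "Pow {1..sum_list \<eta>}"]) (use Ysets_sub in auto)

lemma Y_eq:
  "Y \<eta> = {x \<in> vecs (sum_list \<eta>). (\<Sum>i=1..sum_list \<eta>. x i) = 0 \<and> (\<forall>S\<in>Ysets \<eta>. 0 \<le> sum x S)}"
proof -
  have split: "(\<Sum>j=1..psum \<eta> k. x j) + (\<Sum>a\<in>\<Omega>. x a) = sum x ({1..psum \<eta> k} \<union> \<Omega>)"
    if "\<Omega> \<subseteq> {psum \<eta> k + 1..psum \<eta> (k + 1)}" for x :: "nat \<Rightarrow> 'a" and k \<Omega>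
  proof (rule sum.union_disjoint[symmetric])
    show "finite \<Omega>" using that by (rule finite_subset) simp
    show "{1..psum \<eta> k} \<inter> \<Omega> = {}" using that by fastforce
  qed simp
  have ball: "(\<forall>S\<in>Ysets \<eta>. P S) \<longleftrightarrow> (\<forall>k<length \<eta>. \<forall>\<Omega>. \<Omega> \<subseteq> {psum \<eta> k + 1..psum \<eta> (k + 1)} \<longrightarrow>
      P ({1..psum \<eta> k} \<union> \<Omega>))" for P
    unfolding Ysets_def by blast
  show ?thesis
    unfolding Y_def ball by (intro Collect_cong conj_cong all_cong imp_cong refl) (simp_all only: split)
qed

lemma Y_zero_sum: "(x :: nat \<Rightarrow> real) \<in> Y \<eta> \<Longrightarrow> x \<in> zero_sum (sum_list \<eta>)"
  by (simp add: Y_def zero_sum_def)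

lemma Y_add_scale: "x \<in> Y \<eta> \<Longrightarrow> y \<in> Y \<eta> \<Longrightarrow> 0 \<le> s \<Longrightarrow> (\<lambda>v. x v + s * y v :: real) \<in> Y \<eta>"
  unfolding Y_eq by (auto simp: vecs_def sum.distrib simp flip: sum_distrib_left)

lemma Y_scale: "x \<in> Y \<eta> \<Longrightarrow> 0 \<le> s \<Longrightarrow> (\<lambda>v. s * x v :: real) \<in> Y \<eta>"
  unfolding Y_eq by (auto simp: vecs_def simp flip: sum_distrib_left)

lemma Y_of_int: "(\<lambda>i. real_of_int (\<gamma> i)) \<in> Y \<eta> \<longleftrightarrow> \<gamma> \<in> Y \<eta>"
  unfolding Y_eq vecs_def by (simp flip: of_int_sum)

subsection \<open>Compositions\<close>

text \<open>A single part gives no edges, and then a spanning tree exists only for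
  \<open>n = 1\<close>; that case is treated separately.\<close>

locale composition =
  fixes \<eta> :: "nat list"
  assumes parts_pos: "\<And>a. a \<in> set \<eta> \<Longrightarrow> 0 < a" and two_parts: "2 \<le> length \<eta>"

sublocale composition \<subseteq> dag "sum_list \<eta>" "Phi \<eta>"
  by (rule dag_Phi)

context composition begin

abbreviation n :: nat where "n \<equiv> sum_list \<eta>"

lemma ev_in_Y:
  assumes "e \<in> Phi \<eta>"
  shows "ev e \<in> Y \<eta>"
proof -
  have "0 \<le> sum (ev e) S" if S: "S \<in> Ysets \<eta>" for S
  proof -
    have fin: "finite S" using Ysets_sub[OF S] finite_subset by blast
    obtain k \<Omega> where k: "k < length \<eta>" "\<Omega> \<subseteq> {psum \<eta> k + 1..psum \<eta> (k + 1)}" "S = {1..psum \<eta> k} \<union> \<Omega>"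
      using S by (auto simp: Ysets_def)
    obtain i j l where e: "e = (i, j)" "l \<le> length \<eta>" "1 \<le> i" "i \<le> psum \<eta> l" "psum \<eta> l < j"
      using assms by (auto simp: Phi_def)
    \<comment> \<open>No edge enters \<open>S\<close> from outside: \<open>j\<close> is at most
      \<open>psum \<eta> (k + 1)\<close>, so the cut \<open>psum \<eta> l\<close> before
      \<open>j\<close> is at most \<open>psum \<eta> k\<close>, and \<open>i\<close> lies in the
      part of \<open>S\<close> that is filled completely.\<close>
    have "i \<in> S" if "j \<in> S"
    proof -
      have "j \<le> psum \<eta> (k + 1)"
        using that k psum_mono[of k "k + 1" \<eta>] by fastforce
      then have "\<not> k + 1 \<le> l" using psum_mono[of "k + 1" l \<eta>] e by fastforce
      then have "psum \<eta> l \<le> psum \<eta> k" using psum_mono[of l k \<eta>] by simp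
      then show ?thesis using e k by auto
    qed
    moreover have "sum (ev e) S = of_bool (i \<in> S) - of_bool (j \<in> S)"
    proof -
      have "sum (ev e) S = (\<Sum>v\<in>S. (if v = i then 1 else 0) - (if v = j then 1 else 0))"
        unfolding ev_def e(1) by (intro sum.cong refl) simp
      then show ?thesis using fin by (simp add: sum_subtractf)
    qed
    ultimately show ?thesis by simp
  qed
  then show ?thesis
    using ev_edge[OF assms] by (simp add: Y_eq zero_sum_def)
qed

lemma nonneg_combination_in_Y:
  assumes "\<And>e. 0 \<le> t e"
  shows "(\<lambda>v. \<Sum>e\<in>Phi \<eta>. t e * ev e v) \<in> Y \<eta>"
proof -
  let ?x = "\<lambda>v. \<Sum>e\<in>Phi \<eta>. t e * ev e v"
  have "0 \<le> sum ?x S" if "S \<in> Ysets \<eta>" for S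
  proof -
    have "sum ?x S = (\<Sum>e\<in>Phi \<eta>. t e * sum (ev e) S)"
      by (subst sum.swap) (simp add: sum_distrib_left)
    also have "0 \<le> \<dots>"
    proof (rule sum_nonneg)
      fix e assume "e \<in> Phi \<eta>"
      then have "0 \<le> sum (ev e) S" using ev_in_Y that by (simp add: Y_eq)
      then show "0 \<le> t e * sum (ev e) S" using assms by simp
    qed
    finally show ?thesis .
  qed
  then show ?thesis
    using zero_sum_sum[of "Phi \<eta>" ev n t] ev_edge by (simp add: Y_eq zero_sum_def)
qed

text \<open>
  In the first block with a negative entry \<open>x j < 0\<close>, some earlier \<open>x i\<close> is positive. Moving
  the smaller of the two amounts from \<open>i\<close> to \<open>j\<close> stays in the cone and kills an entry.
\<close>

lemma greedy_step:
  assumes x: "(x :: nat \<Rightarrow> real) \<in> Y \<eta>" and nz: "x \<noteq> (\<lambda>_. 0)"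
  obtains i j where "(i, j) \<in> Phi \<eta>" "0 < x i" "x j < 0"
    "(\<lambda>v. x v - min (x i) (- x j) * ev (i, j) v) \<in> Y \<eta>"
proof -
  have x': "x \<in> vecs n" "(\<Sum>v=1..n. x v) = 0" "\<And>S. S \<in> Ysets \<eta> \<Longrightarrow> 0 \<le> sum x S"
    using x by (auto simp: Y_eq)
  have "\<exists>v\<in>{1..n}. x v < 0"
  proof (rule ccontr)
    assume "\<not> (\<exists>v\<in>{1..n}. x v < 0)"
    then have "0 \<le> x v" if "v \<in> {1..n}" for v using that by (meson not_less)
    then have "\<forall>v\<in>{1..n}. x v = 0" using x'(2) sum_nonneg_eq_0_iff[of "{1..n}" x] by blast
    then have "x v = 0" for v using x'(1) by (cases "v \<in> {1..n}") (auto simp: vecs_def)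
    then show False using nz by blast
  qed
  then obtain v where v: "v \<in> {1..n}" "x v < 0" by blast
  let ?P = "\<lambda>k. \<exists>j\<in>{1..psum \<eta> (Suc k)}. x j < 0"
  have pl: "length \<eta> = Suc (length \<eta> - 1)" using two_parts by simp
  have "?P (length \<eta> - 1)" using v psum_length[of \<eta>] pl by (metis (no_types))
  define k where "k = (LEAST k. ?P k)"
  have k: "?P k" unfolding k_def by (rule LeastI) fact
  have k_len: "k < length \<eta>"
    using Least_le[of ?P, OF \<open>?P (length \<eta> - 1)\<close>] pl unfolding k_def by linarith
  have below: "0 \<le> x i" if "i \<in> {1..psum \<eta> k}" for i
  proof (cases k)
    case 0
    then show ?thesis using that by (simp add: psum_0)
  next
    case (Suc k')
    then have "\<not> ?P k'" using not_less_Least[of k' ?P] unfolding k_def by simp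
    moreover have "i \<in> {1..psum \<eta> (Suc k')}" using that Suc by simp
    ultimately show ?thesis by (meson not_less)
  qed
  obtain j where j: "j \<in> {1..psum \<eta> (Suc k)}" "x j < 0" using k by blast
  have jk: "psum \<eta> k < j" using below[of j] j by fastforce
  have block: "0 \<le> sum x {1..psum \<eta> k} + sum x \<Omega>" if "\<Omega> \<subseteq> {psum \<eta> k + 1..psum \<eta> (k + 1)}" for \<Omega>
  proof -
    have "finite \<Omega>" "{1..psum \<eta> k} \<inter> \<Omega> = {}"
      using that finite_subset[OF that] by fastforce+
    then have "sum x ({1..psum \<eta> k} \<union> \<Omega>) = sum x {1..psum \<eta> k} + sum x \<Omega>"
      by (intro sum.union_disjoint) auto
    moreover have "{1..psum \<eta> k} \<union> \<Omega> \<in> Ysets \<eta>" using that k_len unfolding Ysets_def by blast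
    ultimately show ?thesis using x'(3) by metis
  qed
  have "0 \<le> sum x {1..psum \<eta> k} + sum x {j}" by (rule block) (use j jk in auto)
  then have pos: "0 < sum x {1..psum \<eta> k}" using j(2) by simp
  have "\<exists>i\<in>{1..psum \<eta> k}. 0 < x i"
  proof (rule ccontr)
    assume "\<not> (\<exists>i\<in>{1..psum \<eta> k}. 0 < x i)"
    then have "sum x {1..psum \<eta> k} \<le> 0" by (intro sum_nonpos) (meson not_less)
    then show False using pos by simp
  qed
  then obtain i where i: "i \<in> {1..psum \<eta> k}" "0 < x i" by blast
  define \<tau> where "\<tau> = min (x i) (- x j)"
  have \<tau>: "0 < \<tau>" "\<tau> \<le> x i" "\<tau> \<le> - x j" using i j by (auto simp: \<tau>_def)
  have jn: "j \<le> n" using j psum_le[of \<eta> "Suc k"] by simp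
  have e: "(i, j) \<in> Phi \<eta>"
    using i jk jn k_len by (auto simp: Phi_def intro!: exI[of _ k])
  show thesis
  proof (rule that[OF e i(2) j(2)])
    have "0 \<le> (\<Sum>v\<in>S. x v - \<tau> * ev (i, j) v)" if S: "S \<in> Ysets \<eta>" for S
    proof -
      have fin: "finite S" using Ysets_sub[OF S] finite_subset by blast
      have "(\<Sum>v\<in>S. x v - \<tau> * ev (i, j) v)
          = (\<Sum>v\<in>S. x v - (if v = i then \<tau> else 0) + (if v = j then \<tau> else 0))"
        by (intro sum.cong refl) (simp add: ev_def)
      then have eq: "(\<Sum>v\<in>S. x v - \<tau> * ev (i, j) v)
          = sum x S - (if i \<in> S then \<tau> else 0) + (if j \<in> S then \<tau> else 0)"
        using fin by (simp add: sum.distrib sum_subtractf)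
      show ?thesis
      proof (cases "i \<in> S \<and> j \<notin> S")
        case False
        then show ?thesis unfolding eq using x'(3)[OF S] \<tau>(1) by auto
      next
        case True
        obtain l \<Omega> where l: "l < length \<eta>" "\<Omega> \<subseteq> {psum \<eta> l + 1..psum \<eta> (l + 1)}" "S = {1..psum \<eta> l} \<union> \<Omega>"
          using S by (auto simp: Ysets_def)
        \<comment> \<open>For \<open>l > k\<close> the set \<open>S\<close> would contain the whole
          block of \<open>j\<close>.\<close>
        have "\<not> k + 1 \<le> l" using psum_mono[of "k + 1" l \<eta>] True l(3) j(1) by fastforce
        then consider "l < k" | "l = k" by linarith
        then have "\<tau> \<le> sum x S"
        proof cases
          case 1
          then have "S \<subseteq> {1..psum \<eta> k}"
            using l psum_mono[of "l + 1" k \<eta>] psum_mono[of l "l + 1" \<eta>] by fastforce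
          then have "x i \<le> sum x S"
            using below True fin by (intro member_le_sum) auto
          then show ?thesis using \<tau> by simp
        next
          case 2
          have fO: "finite \<Omega>" using l(2) by (rule finite_subset) simp
          \<comment> \<open>Dropping the nonnegative entries of \<open>\<Omega>\<close> and adding
            \<open>j\<close> gives another admissible set, whose inequality bounds
            \<open>- x j\<close>.\<close>
          define N where "N = {v\<in>\<Omega>. x v < 0}"
          have fN: "finite N" "N \<subseteq> \<Omega>" "j \<notin> N" using fO True l(3) by (auto simp: N_def)
          have "0 \<le> sum x {1..psum \<eta> k} + sum x (insert j N)"
            by (rule block) (use fN l(2) 2 j jk in auto)
          then have "- x j \<le> sum x {1..psum \<eta> k} + sum x N" using fN by simp
          also have "sum x N \<le> sum x \<Omega>"
            by (rule sum_mono2) (use fO in \<open>auto simp: N_def\<close>)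
          finally have "- x j \<le> sum x {1..psum \<eta> k} + sum x \<Omega>" by simp
          also have "\<dots> = sum x S"
            unfolding l(3) 2 by (rule sum.union_disjoint[symmetric]) (use fO l(2) 2 in fastforce)+
          finally show ?thesis using \<tau> by simp
        qed
        then show ?thesis unfolding eq using True by simp
      qed
    qed
    moreover have "(\<lambda>v. x v - \<tau> * ev (i, j) v) \<in> zero_sum n"
      using Y_zero_sum[OF x] ev_edge[OF e] by (rule zero_sum_diff_scale)
    ultimately have "(\<lambda>v. x v - \<tau> * ev (i, j) v) \<in> Y \<eta>"
      by (simp add: Y_eq zero_sum_def)
    then show "(\<lambda>v. x v - min (x i) (- x j) * ev (i, j) v) \<in> Y \<eta>" by (simp only: \<tau>_def)
  qed
qed

text \<open>Each transport removes an entry from the support, and the last one removes two because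
  the entries sum to 0. This yields the number of edges of a tree, and with it the converse of
  \<open>nonneg_combination_in_Y\<close>.\<close>

lemma Y_sparse_combination:
  assumes "(x :: nat \<Rightarrow> real) \<in> Y \<eta>"
  shows "\<exists>t. (\<forall>e. 0 \<le> t e) \<and> (\<forall>v. x v = (\<Sum>e\<in>Phi \<eta>. t e * ev e v)) \<and>
    card {e \<in> Phi \<eta>. t e \<noteq> 0} \<le> card {v \<in> {1..n}. x v \<noteq> 0} - 1"
  using assms
proof (induction "card {v \<in> {1..n}. x v \<noteq> 0}" arbitrary: x rule: less_induct)
  case less
  let ?supp = "\<lambda>x::nat \<Rightarrow> real. {v \<in> {1..n}. x v \<noteq> 0}"
  show ?case
  proof (cases "x = (\<lambda>_. 0)")
    case True
    then show ?thesis by (intro exI[of _ "\<lambda>_. 0"]) simp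
  next
    case False
    obtain i j where ij: "(i, j) \<in> Phi \<eta>" "0 < x i" "x j < 0"
      "(\<lambda>v. x v - min (x i) (- x j) * ev (i, j) v) \<in> Y \<eta>"
      by (rule greedy_step[OF less.prems False])
    define \<tau> where "\<tau> = min (x i) (- x j)"
    define x' where "x' = (\<lambda>v. x v - \<tau> * ev (i, j) v)"
    have x': "x' \<in> Y \<eta>" using ij(4) by (simp add: x'_def \<tau>_def)
    have \<tau>: "0 < \<tau>" using ij by (simp add: \<tau>_def)
    have r: "i \<in> {1..n}" "j \<in> {1..n}" "i \<noteq> j" using edge_range[OF ij(1)] edge[OF ij(1)] by auto
    have "x' v = 0" if "x v = 0" for v
      using ij that by (cases "v = i \<or> v = j") (auto simp: x'_def ev_def)
    then have "?supp x' \<subseteq> ?supp x" by blast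
    moreover have "x' i = 0 \<or> x' j = 0"
      using r(3) by (auto simp: x'_def ev_def \<tau>_def min_def)
    moreover have "i \<in> ?supp x" "j \<in> ?supp x" using r ij by auto
    ultimately have sub: "?supp x' \<subset> ?supp x" by blast
    then have lt: "card (?supp x') < card (?supp x)" by (intro psubset_card_mono) auto
    obtain t where t: "\<And>e. 0 \<le> t e" "\<And>v. x' v = (\<Sum>e\<in>Phi \<eta>. t e * ev e v)"
      "card {e \<in> Phi \<eta>. t e \<noteq> 0} \<le> card (?supp x') - 1"
      using less.hyps[OF lt x'] by blast
    define t' where "t' = t((i, j) := t (i, j) + \<tau>)"
    \<comment> \<open>For \<open>x' = 0\<close> the bound of the induction hypothesis is a truncated
      difference; two nonzero entries of \<open>x\<close> make up for this.\<close>
    have "{i, j} \<subseteq> ?supp x" using r ij by auto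
    then have "card {i, j} \<le> card (?supp x)" by (intro card_mono) auto
    then have two: "2 \<le> card (?supp x)" using r(3) by simp
    have "x v = (\<Sum>e\<in>Phi \<eta>. t' e * ev e v)" for v
    proof -
      have "(\<Sum>e\<in>Phi \<eta>. t' e * ev e v)
          = (\<Sum>e\<in>Phi \<eta>. t e * ev e v + (if e = (i, j) then \<tau> * ev (i, j) v else 0))"
        by (intro sum.cong refl) (auto simp: t'_def algebra_simps)
      also have "\<dots> = x' v + \<tau> * ev (i, j) v"
        using ij(1) finite_edges by (simp add: sum.distrib t(2))
      finally show ?thesis by (simp add: x'_def)
    qed
    moreover have "card {e \<in> Phi \<eta>. t' e \<noteq> 0} \<le> card (?supp x) - 1"
    proof -
      have "card {e \<in> Phi \<eta>. t' e \<noteq> 0} \<le> card (insert (i, j) {e \<in> Phi \<eta>. t e \<noteq> 0})"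
        using finite_edges by (intro card_mono) (auto simp: t'_def)
      also have "\<dots> \<le> Suc (card {e \<in> Phi \<eta>. t e \<noteq> 0})" by (rule card_insert_le_m1) simp_all
      finally show ?thesis using t(3) lt two by linarith
    qed
    moreover have "0 \<le> t' e" for e using t(1)[of e] t(1)[of "(i, j)"] \<tau> by (simp add: t'_def)
    ultimately show ?thesis by blast
  qed
qed

text \<open>The tree is a double star: vertex 1 is joined to everything after the first block, and
  \<open>n\<close> to the rest of the first block.\<close>

lemma bases_nonempty: "bases \<noteq> {}"
proof -
  obtain r s \<zeta> where \<eta>: "\<eta> = r # s # \<zeta>"
    using two_parts by (cases \<eta>; cases "tl \<eta>") auto
  have r: "1 \<le> r" "r < n" using parts_pos[of r] parts_pos[of s] by (auto simp: \<eta>)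
  define B where "B = Pair 1 ` {r<..n} \<union> (\<lambda>i. (i, n)) ` {2..r}"
  \<comment> \<open>Up to a constant, \<open>h b\<close> is the indicator of the side containing the
    tail of \<open>b\<close> when \<open>b\<close> is deleted from the tree.\<close>
  define h where "h = (\<lambda>(i, j) v. if i = 1 then
      if j = n then of_bool (v = 1 \<or> r < v \<and> v < n) else - of_bool (v = j)
    else of_bool (v = i) :: real)"
  have B: "B \<subseteq> Phi \<eta>"
    using r by (auto simp: B_def Phi_def psum_def \<eta> intro!: exI[of _ 1])
  have "card B = card {r<..n} + card {2..r}"
    unfolding B_def by (subst card_Un_disjoint) (auto simp: card_image inj_on_def)
  then have card: "card B = n - 1" using r by simp
  have delta: "lin n (h b) (ev b') = of_bool (b = b')" if "b \<in> B" "b' \<in> B" for b b'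
  proof -
    have "lin n (h b) (ev b') = h b (fst b') - h b (snd b')"
      using lin_ev edge_range B that by blast
    then show ?thesis using that r by (auto simp: B_def h_def split: if_splits)
  qed
  \<comment> \<open>No nonzero zero-sum vector is killed by all functionals, so the expansion
    formula will follow from \<open>delta\<close>.\<close>
  have inj: "w = (\<lambda>_. 0)" if w: "w \<in> zero_sum n" "\<And>b. b \<in> B \<Longrightarrow> lin n (h b) w = 0" for w
  proof -
    have single: "(\<Sum>v=1..n. of_bool (v = i) * w v) = w i" if "i \<in> {1..n}" for i
      using that by (simp add: of_bool_def if_distrib[of "\<lambda>z. z * _"] cong: if_cong)
    have mid: "w i = 0" if "1 < i" "i < n" for i
    proof (cases "i \<le> r")
      case True
      then have "(i, n) \<in> B" using that by (auto simp: B_def)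
      then show ?thesis using w(2)[of "(i, n)"] single[of i] that by (simp add: h_def lin_def)
    next
      case False
      then have "(1, i) \<in> B" using that by (auto simp: B_def)
      then show ?thesis using w(2)[of "(1, i)"] single[of i] that by (simp add: h_def lin_def sum_negf)
    qed
    have "(1, n) \<in> B" using r by (auto simp: B_def)
    then have "0 = (\<Sum>v=1..n. of_bool (v = 1 \<or> r < v \<and> v < n) * w v)"
      using w(2)[of "(1, n)"] by (simp add: h_def lin_def)
    also have "\<dots> = (\<Sum>v=1..n. of_bool (v = 1) * w v)"
      using mid r by (intro sum.cong refl) auto
    also have "\<dots> = w 1" using single[of 1] r by simp
    finally have w1: "w 1 = 0" by simp
    have "0 = sum w {1..n}" using w(1) by (simp add: zero_sum_def)
    also have "\<dots> = sum w {n}"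
    proof (rule sum.mono_neutral_right)
      show "\<forall>i\<in>{1..n} - {n}. w i = 0"
      proof
        fix i assume "i \<in> {1..n} - {n}"
        then show "w i = 0" using mid[of i] w1 by (cases "i = 1") auto
      qed
    qed (use r in auto)
    finally have wn: "w n = 0" by simp
    have "w i = 0" for i
      using mid[of i] w1 wn w(1) by (cases "i \<in> {1..n}"; cases "i = 1"; cases "i = n") (auto simp: zero_sum_def vecs_def)
    then show ?thesis by blast
  qed
  have finB: "finite B" using B finite_edges finite_subset by blast
  have "x v = (\<Sum>b\<in>B. lin n (h b) x * ev b v)" if x: "x \<in> zero_sum n" for x v
  proof -
    let ?y = "\<lambda>v. \<Sum>b\<in>B. lin n (h b) x * ev b v"
    have y: "?y \<in> zero_sum n" by (rule zero_sum_sum) (use B ev_edge in blast)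
    have "(\<lambda>v. x v - 1 * ?y v) = (\<lambda>_. 0)"
    proof (rule inj)
      show "(\<lambda>v. x v - 1 * ?y v) \<in> zero_sum n" using x y by (rule zero_sum_diff_scale)
      fix b assume b: "b \<in> B"
      have "lin n (h b) (\<lambda>v. x v - 1 * ?y v) = lin n (h b) x - 1 * lin n (h b) ?y"
        by (simp only: lin_diff lin_scale)
      also have "lin n (h b) ?y = (\<Sum>b'\<in>B. lin n (h b') x * lin n (h b) (ev b'))"
        by (rule lin_sum)
      also have "\<dots> = (\<Sum>b'\<in>B. if b' = b then lin n (h b') x else 0)"
        by (intro sum.cong refl) (simp add: delta b)
      also have "\<dots> = lin n (h b) x" using finB b by simp
      finally show "lin n (h b) (\<lambda>v. x v - 1 * ?y v) = 0" by simp
    qed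
    from fun_cong[OF this, of v] show ?thesis by simp
  qed
  then have "dual_basis n B h" using card delta unfolding dual_basis_def by blast
  then show ?thesis using B unfolding bases_def by blast
qed

section \<open>Cells of the arrangement of tree coordinates\<close>

definition cell :: "(nat \<Rightarrow> real) \<Rightarrow> (nat \<Rightarrow> real) set" where
  "cell y = {x \<in> Y \<eta>. compatible y x}"

text \<open>Normals of the inequalities of \<open>cell y\<close>; the first two express that the
  coordinate sum is 0. Tree coordinates appear with the coefficients of \<open>co_eq_lin\<close>
  instead of \<open>pot\<close>, which makes all normals integral on \<open>{1..n}\<close>.\<close>

definition walls :: "(nat \<Rightarrow> real) \<Rightarrow> (nat \<Rightarrow> real) set" where
  "walls y = {\<lambda>_. 1, \<lambda>_. -1} \<union> (\<lambda>S v. of_bool (v \<in> S)) ` Ysets \<eta> \<union>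
     (\<lambda>(B, b) i. sgn (co B b y) * co B b (ev (i, n))) ` Sigma bases (\<lambda>B. B)"

lemma finite_walls: "finite (walls y)"
  unfolding walls_def using finite_Ysets finite_bases bases_finite
  by (intro finite_UnI finite_imageI finite_SigmaI) auto

lemma walls_Ints: "h \<in> walls y \<Longrightarrow> i \<in> {1..n} \<Longrightarrow> h i \<in> \<int>"
  unfolding walls_def using co_ev_Ints by (auto simp: sgn_if of_bool_def)

lemma cell_eq: "cell y = {x \<in> vecs n. \<forall>h\<in>walls y. 0 \<le> lin n h x}"
proof -
  have 1: "lin n (\<lambda>_. 1) x = (\<Sum>i=1..n. x i)" "lin n (\<lambda>_. -1) x = - (\<Sum>i=1..n. x i)" for x
    by (simp_all add: lin_def sum_negf)
  have 2: "lin n (\<lambda>v. of_bool (v \<in> S)) x = sum x S" if "S \<in> Ysets \<eta>" for S x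
  proof -
    have "lin n (\<lambda>v. of_bool (v \<in> S)) x = (\<Sum>v=1..n. if v \<in> S then x v else 0)"
      unfolding lin_def by (intro sum.cong refl) simp
    also have "\<dots> = sum x ({1..n} \<inter> S)" by (rule sum.inter_restrict[symmetric]) simp
    finally show ?thesis using Ysets_sub[OF that] by (simp add: Int_absorb1)
  qed
  have 3: "0 \<le> lin n (\<lambda>i. sgn (co B b y) * co B b (ev (i, n))) x \<longleftrightarrow> 0 \<le> co B b x * co B b y"
    if "B \<in> bases" "b \<in> B" "x \<in> zero_sum n" for B b x
    unfolding lin_scale_coeff co_eq_lin[OF that, symmetric]
    by (auto simp: sgn_if zero_le_mult_iff)
  have "x \<in> cell y \<longleftrightarrow> x \<in> vecs n \<and> (\<forall>h\<in>walls y. 0 \<le> lin n h x)" for x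
  proof (cases "x \<in> zero_sum n")
    case True
    have "(\<forall>h\<in>walls y. 0 \<le> lin n h x) \<longleftrightarrow> (\<forall>S\<in>Ysets \<eta>. 0 \<le> sum x S) \<and> compatible y x"
      using True 3 unfolding walls_def compatible_def ball_Un ball_simps
      by (auto simp: 1 2 zero_sum_def)
    then show ?thesis using True unfolding cell_def Y_eq zero_sum_def by auto
  next
    case False
    then show ?thesis
      unfolding cell_def Y_eq zero_sum_def walls_def ball_Un by (auto simp: 1)
  qed
  then show ?thesis by blast
qed

lemma polyhedral_cone_cell: "polyhedral_cone n (cell y)"
  unfolding polyhedral_cone_def cell_eq using finite_walls unfolding lin_def by blast

text \<open>A generic point has no zero coordinate, so its cell depends only on the set of its
  positive coordinates.\<close>

lemma finite_cells: "finite (cell ` {y. generic y})"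
proof -
  define U where "U = Sigma bases (\<lambda>B. B)"
  have finU: "finite U" unfolding U_def
    using finite_bases bases_finite by (intro finite_SigmaI) auto
  define c where "c P = {x \<in> Y \<eta>. \<forall>(B, b)\<in>U. if (B, b) \<in> P then 0 \<le> co B b x else co B b x \<le> 0}" for P
  have "cell y = c {(B, b) \<in> U. 0 < co B b y}" if y: "generic y" for y
  proof -
    have sign: "0 \<le> co B b x * co B b y \<longleftrightarrow>
        (if (B, b) \<in> {(B, b) \<in> U. 0 < co B b y} then 0 \<le> co B b x else co B b x \<le> 0)"
      if "(B, b) \<in> U" for B b x
    proof -
      have "co B b y \<noteq> 0" using y that by (simp add: generic_def U_def)
      then show ?thesis using that by (auto simp: zero_le_mult_iff)
    qed
    have "(\<forall>(B, b)\<in>U. 0 \<le> co B b x * co B b y) \<longleftrightarrow> (\<forall>(B, b)\<in>U.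
        if (B, b) \<in> {(B, b) \<in> U. 0 < co B b y} then 0 \<le> co B b x else co B b x \<le> 0)" for x
    proof (intro ball_cong refl)
      fix u assume "u \<in> U"
      then show "(case u of (B, b) \<Rightarrow> 0 \<le> co B b x * co B b y) \<longleftrightarrow> (case u of (B, b) \<Rightarrow>
          if (B, b) \<in> {(B, b) \<in> U. 0 < co B b y} then 0 \<le> co B b x else co B b x \<le> 0)"
        using sign by (cases u) (simp only: prod.case)
    qed
    moreover have "compatible y x \<longleftrightarrow> (\<forall>(B, b)\<in>U. 0 \<le> co B b x * co B b y)" for x
      by (simp add: compatible_def U_def)
    ultimately show ?thesis unfolding cell_def c_def by blast
  qed
  then have "cell ` {y. generic y} \<subseteq> c ` Pow U" by (auto intro!: imageI)
  then show ?thesis by (rule finite_subset) (simp add: finU)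
qed

text \<open>Add to \<open>x\<close> a small multiple of a generic point of \<open>Y\<close>: nonzero
  coordinates keep their sign, zero coordinates take that of the generic point. The result is
  generic, and \<open>x\<close> lies in its closed cell.\<close>

lemma cells_cover:
  assumes x: "x \<in> Y \<eta>"
  shows "\<exists>y\<in>Y \<eta>. generic y \<and> x \<in> cell y"
proof -
  obtain B0 where "B0 \<in> bases" using bases_nonempty by blast
  then obtain t where t: "\<And>e. 0 \<le> t e" "generic (\<lambda>v. \<Sum>e\<in>Phi \<eta>. t e * ev e v)"
    using exists_generic by blast
  define g where "g = (\<lambda>v. \<Sum>e\<in>Phi \<eta>. t e * ev e v)"
  have g: "g \<in> Y \<eta>" "generic g" unfolding g_def using nonneg_combination_in_Y t by auto
  define U where "U = Sigma bases (\<lambda>B. B)"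
  have finU: "finite U" unfolding U_def
    using finite_bases bases_finite by (intro finite_SigmaI) auto
  have small: "eventually (\<lambda>s. \<forall>(B, b)\<in>U. co B b x \<noteq> 0 \<longrightarrow> s * \<bar>co B b g\<bar> < \<bar>co B b x\<bar>) (at_right 0)"
  proof (rule eventually_ball_finite[OF finU], safe)
    fix B b assume "(B, b) \<in> U"
    show "eventually (\<lambda>s. co B b x \<noteq> 0 \<longrightarrow> s * \<bar>co B b g\<bar> < \<bar>co B b x\<bar>) (at_right 0)"
    proof (cases "co B b x = 0")
      case False
      have "((\<lambda>s. s * \<bar>co B b g\<bar>) \<longlongrightarrow> 0 * \<bar>co B b g\<bar>) (at_right 0)"
        by (intro tendsto_intros)
      then show ?thesis
        using order_tendstoD(2)[of _ "0 * \<bar>co B b g\<bar>" _ "\<bar>co B b x\<bar>"] False by simp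
    qed simp
  qed
  then obtain s where s: "0 < s" "\<And>B b. B \<in> bases \<Longrightarrow> b \<in> B \<Longrightarrow> co B b x \<noteq> 0 \<Longrightarrow> s * \<bar>co B b g\<bar> < \<bar>co B b x\<bar>"
  proof -
    have "eventually (\<lambda>s::real. 0 < s) (at_right 0)" by (rule eventually_at_right_less)
    from eventually_happens'[OF trivial_limit_at_right_real eventually_conj[OF this small]]
    obtain s where s: "0 < s" "\<forall>(B, b)\<in>U. co B b x \<noteq> 0 \<longrightarrow> s * \<bar>co B b g\<bar> < \<bar>co B b x\<bar>"
      by blast
    show thesis
    proof (rule that[OF s(1)])
      fix B b assume "B \<in> bases" "b \<in> B" "co B b x \<noteq> 0"
      then show "s * \<bar>co B b g\<bar> < \<bar>co B b x\<bar>"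
        using bspec[OF s(2), of "(B, b)"] by (simp add: U_def)
    qed
  qed
  define y where "y = (\<lambda>v. x v + s * g v)"
  have co_y: "co B b y = co B b x + s * co B b g" for B b
    unfolding y_def by (simp only: co_linear)
  have sign: "0 \<le> co B b x * co B b y \<and> co B b y \<noteq> 0" if "B \<in> bases" "b \<in> B" for B b
  proof (cases "co B b x = 0")
    case True
    then show ?thesis using g(2) s(1) that by (simp add: co_y generic_def)
  next
    case False
    have "\<bar>s * co B b g\<bar> < \<bar>co B b x\<bar>" using s(2)[OF that False] s(1) by (simp add: abs_mult)
    then show ?thesis unfolding co_y
      by (cases "0 < co B b x") (auto simp: zero_le_mult_iff abs_if split: if_splits)
  qed
  have "y \<in> Y \<eta>" unfolding y_def using x g(1) s(1) by (intro Y_add_scale) auto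
  moreover have "generic y" "x \<in> cell y"
    using sign x by (auto simp: generic_def cell_def compatible_def)
  ultimately show ?thesis by blast
qed

text \<open>The sparse combination places \<open>y\<close> in the cone of a tree, the starting point
  that \<open>card_flows_polynomial\<close> requires.\<close>

lemma cell_polynomial:
  assumes y: "y \<in> Y \<eta>" "generic y"
  obtains f where "polynomial_fun n (card (Phi \<eta>) - (n - 1)) f"
    "\<And>x. x \<in> lattice \<Longrightarrow> x \<in> cell y \<Longrightarrow> real (card (flows (Phi \<eta>) x)) = f x"
proof -
  obtain t where t: "\<And>e. 0 \<le> t e" "\<And>v. y v = (\<Sum>e\<in>Phi \<eta>. t e * ev e v)"
    "card {e \<in> Phi \<eta>. t e \<noteq> 0} \<le> card {v \<in> {1..n}. y v \<noteq> 0} - 1"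
    using Y_sparse_combination[OF y(1)] by blast
  have "card {v \<in> {1..n}. y v \<noteq> 0} \<le> card {1..n}" by (intro card_mono) auto
  then have "card {e \<in> Phi \<eta>. t e \<noteq> 0} \<le> n - 1" using t(3) by simp
  then obtain B where "B \<in> bases" "\<And>b. b \<in> B \<Longrightarrow> 0 < co B b y"
    using generic_in_basis_cone[OF bases_nonempty y(2) t(1,2)] by blast
  then show thesis
    using card_flows_polynomial[OF Y_zero_sum[OF y(1)] y(2)] that by (metis (no_types, lifting) cell_def mem_Collect_eq)
qed

lemma kostant_piecewise_polynomial:
  obtains F where "\<And>\<gamma>. \<gamma> \<in> Y \<eta> \<Longrightarrow> real (kostant n (Phi \<eta>) \<gamma>) = F (\<lambda>i. real_of_int (\<gamma> i))"
    "piecewise_polynomial_of_degree_on n (card (Phi \<eta>) - (n - 1)) (Y \<eta>) F"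
proof -
  define d where "d = card (Phi \<eta>) - (n - 1)"
  define G where "G = {y \<in> Y \<eta>. generic y}"
  have "\<forall>y\<in>G. \<exists>f. polynomial_fun n d f \<and> (\<forall>x\<in>lattice \<inter> cell y. real (card (flows (Phi \<eta>) x)) = f x)"
    unfolding G_def d_def using cell_polynomial by (metis (no_types, lifting) Int_iff mem_Collect_eq)
  then obtain f where f: "\<And>y. y \<in> G \<Longrightarrow> polynomial_fun n d (f y)"
    "\<And>y x. y \<in> G \<Longrightarrow> x \<in> lattice \<Longrightarrow> x \<in> cell y \<Longrightarrow> real (card (flows (Phi \<eta>) x)) = f y x"
    unfolding bchoice_iff by blast
  \<comment> \<open>The common part is cut out by the integral walls of both cells, and on its
    lattice points both polynomials count the same flows.\<close>
  have agree: "f y x = f y' x" if y: "y \<in> G" "y' \<in> G" and x: "x \<in> cell y" "x \<in> cell y'" for y y' x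
  proof -
    have "f y x + (-1) * f y' x = 0"
    proof (rule polynomial_fun_eq_0_on_cone[where g = "\<lambda>x. f y x + (-1) * f y' x" and x = x
          and n = n and d = d and L = "walls y \<union> walls y'"])
      show "finite (walls y \<union> walls y')" using finite_walls by simp
      show "h i \<in> \<int>" if "h \<in> walls y \<union> walls y'" "i \<in> {1..n}" for h i
        using that walls_Ints by blast
      show "x \<in> vecs n" using x(1) by (simp add: cell_eq)
      show "0 \<le> lin n h x" if "h \<in> walls y \<union> walls y'" for h
        using that x by (auto simp: cell_eq)
      show "polynomial_fun n d (\<lambda>x. f y x + (-1) * f y' x)"
        by (intro polynomial_fun_add polynomial_fun_cmult f y)
      fix z :: "nat \<Rightarrow> real"
      assume z: "z \<in> vecs n" "\<And>i. z i \<in> \<int>" "\<And>h. h \<in> walls y \<union> walls y' \<Longrightarrow> 0 \<le> lin n h z"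
      then have "z \<in> cell y" "z \<in> cell y'" by (auto simp: cell_eq)
      moreover from this have "z \<in> lattice"
        using z(2) Y_zero_sum by (auto simp: cell_def lattice_def)
      ultimately show "f y z + (-1) * f y' z = 0"
        using f(2)[OF y(1), of z] f(2)[OF y(2), of z] by simp
    qed
    then show ?thesis by simp
  qed
  \<comment> \<open>By \<open>agree\<close> the choice of the cell is immaterial.\<close>
  define F where "F x = f (SOME y. y \<in> G \<and> x \<in> cell y) x" for x
  have F: "F x = f y x" if "y \<in> G" "x \<in> cell y" for x y
  proof -
    have "(SOME y. y \<in> G \<and> x \<in> cell y) \<in> G \<and> x \<in> cell (SOME y. y \<in> G \<and> x \<in> cell y)"
      by (rule someI[of "\<lambda>y. y \<in> G \<and> x \<in> cell y"]) (use that in blast)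
    then show ?thesis unfolding F_def using agree that by blast
  qed
  have F_lattice: "real (card (flows (Phi \<eta>) x)) = F x" if x: "x \<in> lattice" "x \<in> Y \<eta>" for x
  proof -
    obtain y where "y \<in> G" "x \<in> cell y" using cells_cover[OF x(2)] by (auto simp: G_def)
    then show ?thesis using f(2) F x(1) by simp
  qed
  show thesis
  proof (rule that)
    fix \<gamma> :: "nat \<Rightarrow> int" assume \<gamma>: "\<gamma> \<in> Y \<eta>"
    then have "(\<lambda>i. real_of_int (\<gamma> i)) \<in> Y \<eta>" by (simp add: Y_of_int)
    moreover from this have "(\<lambda>i. real_of_int (\<gamma> i)) \<in> lattice"
      using Y_zero_sum by (simp add: lattice_def)
    moreover have "\<gamma> \<in> vecs n" using \<gamma> by (simp add: Y_def)
    ultimately show "real (kostant n (Phi \<eta>) \<gamma>) = F (\<lambda>i. real_of_int (\<gamma> i))"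
      using F_lattice by (simp add: kostant_eq_card_flows)
  next
    have "piecewise_polynomial_on n d (Y \<eta>) F"
      unfolding piecewise_polynomial_on_def
    proof (intro exI[of _ "cell ` G"] conjI ballI)
      show "finite (cell ` G)"
        by (rule finite_subset[OF _ finite_cells]) (auto simp: G_def)
      show "\<Union> (cell ` G) = Y \<eta>"
        using cells_cover by (auto simp: G_def) (auto simp: cell_def)
    next
      fix C assume "C \<in> cell ` G"
      then obtain y where y: "y \<in> G" "C = cell y" by blast
      show "polyhedral_cone n C" unfolding y by (rule polyhedral_cone_cell)
      show "\<exists>f. polynomial_fun n d f \<and> (\<forall>x\<in>C. F x = f x)"
        using f(1)[OF y(1)] F[OF y(1)] unfolding y by blast
    qed
    moreover have False if d': "d' < d" and pw: "piecewise_polynomial_on n d' (Y \<eta>) F" for d'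
    proof -
      obtain B0 where "B0 \<in> bases" using bases_nonempty by blast
      then obtain t where t: "\<And>b. 0 \<le> t b" "(\<lambda>v. \<Sum>b\<in>Phi \<eta>. t b * ev b v) \<in> lattice"
        "\<And>k::nat. (k + 1) ^ d \<le> card (flows (Phi \<eta>) (\<lambda>v. real k * (\<Sum>b\<in>Phi \<eta>. t b * ev b v)))"
        using card_flows_growth unfolding d_def by blast
      define x where "x = (\<lambda>v. \<Sum>b\<in>Phi \<eta>. t b * ev b v)"
      have x: "x \<in> Y \<eta>" unfolding x_def using t(1) by (rule nonneg_combination_in_Y)
      have kx: "(\<lambda>v. real k * x v) \<in> lattice" for k
        using t(2) zero_sum_scale[of x n "real k"] by (simp add: lattice_def x_def)
      obtain \<C> where "\<Union>\<C> = Y \<eta>" and pieces: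
        "\<forall>C\<in>\<C>. polyhedral_cone n C \<and> (\<exists>g. polynomial_fun n d' g \<and> (\<forall>x\<in>C. F x = g x))"
        using pw unfolding piecewise_polynomial_on_def by blast
      then obtain C where C: "x \<in> C" "C \<in> \<C>" using x by blast
      obtain g where g: "polyhedral_cone n C" "polynomial_fun n d' g" "\<And>x. x \<in> C \<Longrightarrow> F x = g x"
        using bspec[OF pieces C(2)] by blast
      \<comment> \<open>Pieces are cones, so the piece containing \<open>x\<close> contains its
        whole ray, and a single polynomial of degree \<open>d'\<close> has to match growth of order
        \<open>k ^ d\<close>.\<close>
      have kC: "(\<lambda>v. real k * x v) \<in> C" for k
      proof -
        obtain L where L: "C = {x \<in> vecs n. \<forall>a\<in>L. 0 \<le> lin n a x}"
          using g(1) unfolding polyhedral_cone_def lin_def by blast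
        show ?thesis using C(1) unfolding L by (auto simp: vecs_def lin_scale)
      qed
      obtain c where c: "\<And>k::nat. 1 \<le> k \<Longrightarrow> g (\<lambda>i. real k * x i) \<le> c * real k ^ d'"
        using polynomial_fun_ray_bound[OF g(2), of x] by blast
      obtain k :: nat where k: "\<bar>c\<bar> + 1 < real k" using reals_Archimedean2 by blast
      have k1: "1 \<le> k" using k by linarith
      have "real k ^ Suc d' \<le> real k ^ d" using k1 d' by (intro power_increasing) auto
      also have "\<dots> \<le> real (k + 1) ^ d" by (intro power_mono) auto
      also have "\<dots> \<le> real (card (flows (Phi \<eta>) (\<lambda>v. real k * x v)))"
        using of_nat_mono[OF t(3)[of k], where 'a = real] unfolding x_def by (simp only: of_nat_power)
      also have "\<dots> = g (\<lambda>v. real k * x v)"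
        using F_lattice[OF kx Y_scale[OF x]] g(3)[OF kC] by simp
      also have "\<dots> \<le> c * real k ^ d'" by (rule c[OF k1])
      finally have "real k * real k ^ d' \<le> c * real k ^ d'" by simp
      moreover have "0 < real k ^ d'" using k1 by simp
      ultimately have "real k \<le> c" by (simp only: mult_le_cancel_right_pos)
      then show False using k by linarith
    qed
    ultimately show "piecewise_polynomial_of_degree_on n (card (Phi \<eta>) - (n - 1)) (Y \<eta>) F"
      unfolding piecewise_polynomial_of_degree_on_def d_def by blast
  qed
qed

end

theorem theorem3p25:
  fixes \<eta> :: "nat list" and n :: nat
  assumes "\<eta> \<noteq> []" and "\<forall>a\<in>set \<eta>. 0 < a" and "sum_list \<eta> = n"
  shows "\<exists>F :: (nat \<Rightarrow> real) \<Rightarrow> real.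
    (\<forall>\<gamma>\<in>(Y \<eta> :: (nat \<Rightarrow> int) set). real (kostant n (Phi \<eta>) \<gamma>) = F (\<lambda>i. real_of_int (\<gamma> i))) \<and>
    continuous_on (Y \<eta>) F \<and>
    piecewise_polynomial_of_degree_on n
      (nat (int (\<Sum>j<length \<eta>. \<Sum>i<j. \<eta> ! i * \<eta> ! j) - int n + 1)) (Y \<eta>) F"
proof -
  obtain a \<zeta> where a: "\<eta> = a # \<zeta>" using assms(1) by (cases \<eta>) auto
  have n: "1 \<le> n" using assms(2,3) a by auto
  \<comment> \<open>Since \<open>n\<close> is positive, cutting off at 0 is the subtraction of
    natural numbers.\<close>
  have d: "nat (int (\<Sum>j<length \<eta>. \<Sum>i<j. \<eta> ! i * \<eta> ! j) - int n + 1) = card (Phi \<eta>) - (n - 1)"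
    unfolding card_Phi[symmetric] using n by linarith
  show ?thesis
  proof (cases "2 \<le> length \<eta>")
    case True
    interpret composition \<eta> using assms(2) True by unfold_locales auto
    obtain F where F: "\<And>\<gamma>. \<gamma> \<in> Y \<eta> \<Longrightarrow> real (kostant (sum_list \<eta>) (Phi \<eta>) \<gamma>) = F (\<lambda>i. real_of_int (\<gamma> i))"
      "piecewise_polynomial_of_degree_on (sum_list \<eta>) (card (Phi \<eta>) - (sum_list \<eta> - 1)) (Y \<eta>) F"
      using kostant_piecewise_polynomial by blast
    then show ?thesis
      unfolding d assms(3)
      by (intro exI[of _ F] conjI)
         (auto simp: piecewise_polynomial_of_degree_on_def intro: piecewise_polynomial_continuous_on)
  next
    case False
    \<comment> \<open>In a single block every singleton is admissible, so all entries are
      nonnegative with sum 0. Only the origin remains, and without edges its only flow is the zero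
      flow.\<close>
    then have \<eta>: "\<eta> = [n]" using a assms(3) by (cases \<zeta>) auto
    have Phi: "Phi \<eta> = {}" unfolding \<eta> by (auto simp: Phi_def psum_def take_Cons split: nat.splits)
    have zero: "x = (\<lambda>_. 0)" if x: "x \<in> Y \<eta>" for x :: "nat \<Rightarrow> 'a::linordered_idom"
    proof -
      have "{i} \<in> Ysets \<eta>" if "i \<in> {1..n}" for i
        unfolding Ysets_def \<eta> using that by (auto simp: psum_def intro!: exI[of _ 0])
      then have "\<And>i. i \<in> {1..n} \<Longrightarrow> 0 \<le> x i" using x unfolding Y_eq by force
      moreover have "sum x {1..n} = 0" using x assms(3) by (simp add: Y_eq)
      ultimately have 0: "\<forall>i\<in>{1..n}. x i = 0" using sum_nonneg_eq_0_iff[of "{1..n}" x] by blast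
      have "x i = 0" for i
        using 0 x assms(3) by (cases "i \<in> {1..n}") (simp_all add: Y_eq vecs_def)
      then show ?thesis by blast
    qed
    have Y: "(Y \<eta> :: (nat \<Rightarrow> real) set) = {\<lambda>_. 0}"
      using zero by (auto simp: Y_eq vecs_def)
    have "polyhedral_cone n {\<lambda>_. 0}"
      unfolding polyhedral_cone_def
    proof (intro exI conjI)
      let ?L = "(\<lambda>j i. of_bool (i = j)) ` {1..n} \<union> (\<lambda>j i. - of_bool (i = j)) ` {1..n} :: (nat \<Rightarrow> real) set"
      show "finite ?L" by simp
      have single: "(\<Sum>i=1..n. of_bool (i = j) * x i) = x j" if "j \<in> {1..n}" for j and x :: "nat \<Rightarrow> real"
        using that by (simp add: of_bool_def if_distrib[of "\<lambda>z. z * _"] cong: if_cong)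
      show "{\<lambda>_. 0} = {x \<in> vecs n. \<forall>a\<in>?L. 0 \<le> (\<Sum>i = 1..n. a i * x i)}"
      proof (intro equalityI subsetI)
        fix x :: "nat \<Rightarrow> real" assume x: "x \<in> {x \<in> vecs n. \<forall>a\<in>?L. 0 \<le> (\<Sum>i = 1..n. a i * x i)}"
        have "x j = 0" if "j \<in> {1..n}" for j
        proof -
          have L: "\<forall>a\<in>?L. 0 \<le> (\<Sum>i = 1..n. a i * x i)"
            by (rule CollectD[OF x, THEN conjunct2])
          have "0 \<le> (\<Sum>i=1..n. of_bool (i = j) * x i)"
            by (rule bspec[OF L UnI1[OF imageI[OF that, of "\<lambda>j i. of_bool (i = j) :: real"]]])
          moreover have "0 \<le> (\<Sum>i=1..n. - of_bool (i = j) * x i)"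
            by (rule bspec[OF L UnI2[OF imageI[OF that, of "\<lambda>j i. - of_bool (i = j) :: real"]]])
          ultimately show ?thesis using single[OF that, of x] by (simp add: sum_negf)
        qed
        then have "x j = 0" for j
          using x by (cases "j \<in> {1..n}") (simp_all add: vecs_def)
        then show "x \<in> {\<lambda>_. 0}" by blast
      qed (auto simp: vecs_def)
    qed
    then have "piecewise_polynomial_on n 0 (Y \<eta>) (\<lambda>_. 1)"
      unfolding piecewise_polynomial_on_def Y
      by (intro exI[of _ "{{\<lambda>_. 0}}"]) (auto intro: polynomial_fun_const)
    moreover have "real (kostant n (Phi \<eta>) \<gamma>) = 1" if "\<gamma> \<in> Y \<eta>" for \<gamma>
    proof -
      have "{m :: nat \<times> nat \<Rightarrow> nat. \<forall>e. m e = 0} = {\<lambda>_. 0}" by auto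
      then show ?thesis unfolding Phi kostant_def zero[OF that] by simp
    qed
    ultimately show ?thesis
      unfolding d Phi by (intro exI[of _ "\<lambda>_. 1"]) (simp add: piecewise_polynomial_of_degree_on_def)
  qed
qed

end
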